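(* Let $X=(X_1,X_2)$ be bivariate log-normal, $X_i=\exp(Z_i)$ with $Z=(Z_1,Z_2)\sim\mathcal{N}_2(\mu,A)$, where $\mu\in\mathbb{R}^2$ and $A$ is a symmetric positive definite $2\times2$ matrix. For $\alpha\in(0,1)$ let $q_\alpha(u)$ denote the $\alpha$-quantile of $u_1X_1+u_2X_2$. Then for all $u=(u_1,u_2)\neq(0,0)$ with $u_1\ge0$ and $u_2\ge0$ there exists a level $\alpha_0\in(0,1)$ such that $q_\alpha$ is convex at $u$ for all $1>\alpha\ge\alpha_0$.
   Context: $q_\alpha(u)=\inf\{y\in\mathbb{R}:P(u_1X_1+u_2X_2\le y)\ge\alpha\}$, regarded as a function of $u$ at fixed $\alpha$. Convexity is understood pointwise through the Hessian in $u$: $q_\alpha$ is convex at $u$ if $\langle v,\frac{\delta^2q_\alpha}{\delta u^2}(u)v\rangle\ge0$ for all $v\in\mathbb{R}^2$; at points with $u_1=0$ or $u_2=0$ the derivatives are understood as one-sided derivatives from within the quadrant $\{u_1\ge0,u_2\ge0\}$. *)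

theory Defs
  imports "HOL-Probability.Probability"
begin

definition sym_pos_def :: "real ^ 'n ^ 'n \<Rightarrow> bool" where
  "sym_pos_def A \<longleftrightarrow> transpose A = A \<and> (\<forall>v. v \<noteq> 0 \<longrightarrow> v \<bullet> (A *v v) > 0)"

text \<open>Lebesgue density of the normal law with mean \<open>\<mu>\<close> and covariance matrix \<open>A\<close>
  (\<open>A\<close> symmetric positive definite).\<close>

definition mvnormal_density :: "real ^ 'n \<Rightarrow> real ^ 'n ^ 'n \<Rightarrow> real ^ 'n \<Rightarrow> real" where
  "mvnormal_density \<mu> A z =
     exp (- ((z - \<mu>) \<bullet> (matrix_inv A *v (z - \<mu>))) / 2) / sqrt ((2 * pi) ^ CARD('n) * det A)"

definition quantile :: "'a measure \<Rightarrow> ('a \<Rightarrow> real) \<Rightarrow> real \<Rightarrow> real" where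
  "quantile M Y \<alpha> = Inf {y. measure M {\<omega> \<in> space M. Y \<omega> \<le> y} \<ge> \<alpha>}"

definition quadrant :: "(real ^ 2) set" where
  "quadrant = {w. w $ 1 \<ge> 0 \<and> w $ 2 \<ge> 0}"

text \<open>\<open>H\<close> is the Hessian of \<open>f\<close> at \<open>u\<close>, i.e. the derivative of the gradient \<open>g\<close> of \<open>f\<close>, where
  only increments that stay in \<open>S\<close> are considered, both for \<open>f\<close> and for \<open>g\<close>. At interior points
  of \<open>S\<close> this is the usual Hessian; at boundary points the derivatives are one-sided.\<close>

definition has_hessian_within ::
  "(real ^ 'n \<Rightarrow> real) \<Rightarrow> real ^ 'n ^ 'n \<Rightarrow> real ^ 'n \<Rightarrow> (real ^ 'n) set \<Rightarrow> bool" where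
  "has_hessian_within f H u S \<longleftrightarrow>
     (\<exists>g. (\<forall>\<^sub>F w in nhds u. w \<in> S \<longrightarrow> (f has_derivative (\<lambda>h. g w \<bullet> h)) (at w within S)) \<and>
          (g has_derivative (\<lambda>h. H *v h)) (at u within S))"

text \<open>The existence of the Hessian is part of the notion; on the quadrant the Hessian is
  unique (\<open>has_hessian_within_quadrant_unique\<close> below).\<close>

definition convex_at :: "(real ^ 2 \<Rightarrow> real) \<Rightarrow> real ^ 2 \<Rightarrow> bool" where
  "convex_at f u \<longleftrightarrow>
     (\<exists>H. has_hessian_within f H u quadrant \<and> (\<forall>v. v \<bullet> (H *v v) \<ge> 0))"

lemma quadrant_derivative_unique:
  fixes f :: "real ^ 2 \<Rightarrow> 'b::real_normed_vector"
  assumes "w \<in> quadrant"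
    and "(f has_derivative D) (at w within quadrant)"
    and "(f has_derivative D') (at w within quadrant)"
  shows "D = D'"
proof (rule frechet_derivative_unique_within[OF assms(2,3)])
  fix i :: "real ^ 2" and e :: real
  assume "i \<in> Basis" "e > 0"
  then obtain k where "i = axis k 1"
    by (auto simp: Basis_vec_def)
  then have "w + (e / 2) *\<^sub>R i \<in> quadrant"
    using assms(1) \<open>e > 0\<close> by (auto simp: quadrant_def axis_def)
  then show "\<exists>d. 0 < \<bar>d\<bar> \<and> \<bar>d\<bar> < e \<and> w + d *\<^sub>R i \<in> quadrant"
    using \<open>e > 0\<close> by (intro exI[of _ "e / 2"]) auto
qed

lemma has_hessian_within_quadrant_unique:
  assumes u: "u \<in> quadrant"
    and "has_hessian_within f H u quadrant" "has_hessian_within f H' u quadrant"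
  shows "H = H'"
proof -
  obtain g where g: "\<forall>\<^sub>F w in nhds u. w \<in> quadrant \<longrightarrow>
        (f has_derivative (\<lambda>h. g w \<bullet> h)) (at w within quadrant)"
    and H: "(g has_derivative (\<lambda>h. H *v h)) (at u within quadrant)"
    using assms(2) unfolding has_hessian_within_def by blast
  obtain g' where g': "\<forall>\<^sub>F w in nhds u. w \<in> quadrant \<longrightarrow>
        (f has_derivative (\<lambda>h. g' w \<bullet> h)) (at w within quadrant)"
    and H': "(g' has_derivative (\<lambda>h. H' *v h)) (at u within quadrant)"
    using assms(3) unfolding has_hessian_within_def by blast
  have eq: "\<forall>\<^sub>F w in nhds u. w \<in> quadrant \<longrightarrow> g w = g' w"
    using g g'
  proof eventually_elim
    case (elim w)
    show ?case
    proof
      assume "w \<in> quadrant"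
      then have "(\<lambda>h. g w \<bullet> h) = (\<lambda>h. g' w \<bullet> h)"
        using elim quadrant_derivative_unique by blast
      then show "g w = g' w" by (metis vector_eq_rdot inner_commute)
    qed
  qed
  have "\<forall>\<^sub>F w in at u within quadrant. g' w = g w"
    using eq by (auto simp: eventually_at_filter elim: eventually_mono)
  moreover have "g' u = g u"
    using eventually_nhds_x_imp_x[OF eq] u by simp
  ultimately have "(g has_derivative (\<lambda>h. H' *v h)) (at u within quadrant)"
    using H' u by (auto intro: has_derivative_transform_eventually)
  then have "(\<lambda>h. H *v h) = (\<lambda>h. H' *v h)"
    using quadrant_derivative_unique[OF u H] by blast
  then show ?thesis by (metis matrix_eq)
qed

end

theory Submission
  imports Defs
begin

text \<open>
  With \<open>d = Z$j - Z$i\<close> one has \<open>u$i * X$i + u$j * X$j = exp (Z$i) * (u$i + u$j * exp d)\<close>. Conditioning on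
  \<open>d\<close> turns the distribution function into a Gaussian mixture of normal distribution functions, smooth
  up to the boundary \<open>u$j = 0\<close> as long as \<open>u$i > 0\<close>. By homogeneity the quantile is
  \<open>u$i * exp (L (u$j / u$i))\<close>, so its Hessian is of rank one and only the sign of the second derivative
  of \<open>exp (L t)\<close> matters. Up to a positive factor this derivative is the integral of
  \<open>\<psi> d * \<phi> (\<theta> d) * (s * \<theta> d - 1) * (D d - r)\<^sup>2\<close> over \<open>d\<close>, where
  \<open>\<theta> d = s * (L t - ln (1 + t * exp d) - m - k * d)\<close>, \<open>D d = exp d / (1 + t * exp d)\<close> and \<open>r = L' t\<close>.
  For a large quantile \<open>L t\<close> the integrand is negative only for \<open>d\<close> far out in the tails of \<open>\<psi>\<close>, where
  it is outweighed, uniformly in \<open>r\<close>, by the contribution of points slightly nearer to the origin.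
\<close>

section \<open>Differentiation under the integral and the normal distribution\<close>

text \<open>Origin of the curvature formula: \<open>r\<close> is the mean of \<open>D\<close> under
  the weight \<open>\<psi> * \<phi>\<close>. Differentiating the level equation twice, the rule
  \<open>\<phi>' x = - x * \<phi> x\<close> produces the term with \<open>s * \<theta>\<close>. The
  derivative of \<open>D\<close> in \<open>t\<close>, which is minus its square, combines with the
  square of \<open>r\<close> that the exponential in \<open>exp (L t)\<close> contributes; together
  they are minus the weighted variance of \<open>D\<close>, which is the \<open>- 1\<close>. The
  obstacle is that \<open>r\<close> moves with the level. It is not enough that the negative region
  has small mass, since the squared factor may be small where the mass sits and large in the tail
  (\<open>D d = exp d\<close> at \<open>t = 0\<close>). No asymptotics of \<open>r\<close> are used:
  the inequality is proved for every real \<open>r\<close>. This is possible because, up to a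
  monotone factor, \<open>D d - r\<close> ranges over a two-parameter family, so its size far out is
  controlled by its mean square on an interval of length two, with a loss that is exponential in the
  distance and hence absorbed by a Gaussian tail. All derivatives are taken within
  \<open>t \<ge> 0\<close>, so the edge of the quadrant needs no separate argument.\<close>

lemma has_derivative_integral_dominated:
  fixes f :: "'p::real_normed_vector \<Rightarrow> 'a \<Rightarrow> real"
  assumes S: "convex S" "p0 \<in> S"
    and f: "\<And>p. p \<in> S \<Longrightarrow> integrable M (f p)"
    and f': "\<And>h. integrable M (\<lambda>x. f' p0 x h)"
    and deriv: "\<And>p x. p \<in> S \<Longrightarrow> x \<in> space M \<Longrightarrow> ((\<lambda>p. f p x) has_derivative f' p x) (at p within S)"
    and bound: "\<And>p x h. p \<in> S \<Longrightarrow> x \<in> space M \<Longrightarrow> \<bar>f' p x h\<bar> \<le> B x * norm h"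
    and B: "integrable M B"
  shows "((\<lambda>p. \<integral>x. f p x \<partial>M) has_derivative (\<lambda>h. \<integral>x. f' p0 x h \<partial>M)) (at p0 within S)"
proof (rule has_derivativeI)
  have lin: "bounded_linear (f' p0 x)" if "x \<in> space M" for x
    using deriv[OF S(2) that] by (rule has_derivative_bounded_linear)
  have sp: "f' p0 x (h + h') = f' p0 x h + f' p0 x h'"
    "f' p0 x (c *\<^sub>R h) = c * f' p0 x h" if "x \<in> space M" for x c h h'
    using lin[OF that] by (simp_all add: linear_simps)
  show "bounded_linear (\<lambda>h. \<integral>x. f' p0 x h \<partial>M)"
  proof (rule bounded_linear_intro)
    fix h h' :: 'p
    have "(\<integral>x. f' p0 x (h + h') \<partial>M) = (\<integral>x. f' p0 x h + f' p0 x h' \<partial>M)"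
      by (intro Bochner_Integration.integral_cong refl sp)
    then show "(\<integral>x. f' p0 x (h + h') \<partial>M) = (\<integral>x. f' p0 x h \<partial>M) + (\<integral>x. f' p0 x h' \<partial>M)"
      using f' by simp
  next
    fix c and h :: 'p
    have "(\<integral>x. f' p0 x (c *\<^sub>R h) \<partial>M) = (\<integral>x. c * f' p0 x h \<partial>M)"
      by (intro Bochner_Integration.integral_cong refl sp)
    then show "(\<integral>x. f' p0 x (c *\<^sub>R h) \<partial>M) = c *\<^sub>R (\<integral>x. f' p0 x h \<partial>M)"
      by simp
  next
    fix h :: 'p
    have "norm (\<integral>x. f' p0 x h \<partial>M) \<le> (\<integral>x. B x * norm h \<partial>M)"
      using B f'[of h]
      by (intro order_trans[OF integral_norm_bound integral_mono]) (auto intro: bound[OF S(2)])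
    then show "norm (\<integral>x. f' p0 x h \<partial>M) \<le> norm h * (\<integral>x. B x \<partial>M)"
      by (simp add: mult.commute)
  qed
next
  \<comment> \<open>The normalised remainder tends to 0 pointwise and is dominated by
    \<open>2 * B\<close>: one \<open>B\<close> bounds the difference quotient, by the mean value
    inequality on the convex set \<open>S\<close>, the other bounds the linear term.\<close>
  define R where "R y x = ((f y x - f p0 x) - f' p0 x (y - p0)) /\<^sub>R norm (y - p0)" for y x
  have int_R: "integrable M (R y)" if "y \<in> S" for y
    unfolding R_def using f[OF that] f[OF S(2)] f' by simp
  have "((\<lambda>y. \<integral>x. R y x \<partial>M) \<longlongrightarrow> 0) (at p0 within S)"
    unfolding tendsto_at_iff_sequentially
  proof (intro allI impI)
    fix X assume X: "\<forall>i. X i \<in> S - {p0}" "X \<longlonglongrightarrow> p0"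
    have "(\<lambda>i. \<integral>x. R (X i) x \<partial>M) \<longlonglongrightarrow> (\<integral>x. 0 \<partial>M)"
    proof (rule integral_dominated_convergence[where w="\<lambda>x. 2 * B x"])
      show "AE x in M. (\<lambda>i. R (X i) x) \<longlonglongrightarrow> 0"
      proof (rule AE_I2)
        fix x assume "x \<in> space M"
        then have "((\<lambda>y. R y x) \<longlongrightarrow> 0) (at p0 within S)"
          using deriv[OF S(2)] by (simp add: R_def has_derivative_at_within)
        then show "(\<lambda>i. R (X i) x) \<longlonglongrightarrow> 0"
          using X unfolding tendsto_at_iff_sequentially comp_def by blast
      qed
    next
      fix i
      show "AE x in M. norm (R (X i) x) \<le> 2 * B x"
      proof (rule AE_I2)
        fix x assume x: "x \<in> space M"
        have Bx: "0 \<le> B x"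
        proof -
          have "0 \<le> B x * norm (X i - p0)" using bound[OF S(2) x] by (rule order_trans[OF abs_ge_zero])
          then show ?thesis using X by (auto simp: zero_le_mult_iff)
        qed
        have y: "X i \<in> S" "X i \<noteq> p0" using X by auto
        have "norm (f (X i) x - f p0 x) \<le> B x * norm (X i - p0)"
        proof (rule differentiable_bound[OF S(1) deriv[OF _ x] _ y(1) S(2)])
          show "onorm (f' q x) \<le> B x" if "q \<in> S" for q
            by (rule onorm_bound) (auto simp: Bx bound[OF that x])
        qed
        moreover have "\<bar>f' p0 x (X i - p0)\<bar> \<le> B x * norm (X i - p0)"
          using bound[OF S(2) x] .
        ultimately have "\<bar>f (X i) x - f p0 x - f' p0 x (X i - p0)\<bar> \<le> 2 * B x * norm (X i - p0)"
          by (simp add: algebra_simps)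
        then show "norm (R (X i) x) \<le> 2 * B x"
          using y(2) by (simp add: R_def divide_simps abs_mult)
      qed
    qed (use B int_R X in \<open>auto simp: borel_measurable_integrable\<close>)
    then show "((\<lambda>y. \<integral>x. R y x \<partial>M) \<circ> X) \<longlonglongrightarrow> 0"
      by (simp add: comp_def)
  qed
  moreover have "(\<integral>x. R y x \<partial>M) = (((\<integral>x. f y x \<partial>M) - (\<integral>x. f p0 x \<partial>M)) - (\<integral>x. f' p0 x (y - p0) \<partial>M)) /\<^sub>R norm (y - p0)"
    if "y \<in> S" for y
    unfolding R_def using f[OF that] f[OF S(2)] f' by simp
  ultimately show "((\<lambda>y. ((\<integral>x. f y x \<partial>M) - (\<integral>x. f p0 x \<partial>M) - (\<integral>x. f' p0 x (y - p0) \<partial>M)) /\<^sub>R norm (y - p0)) \<longlongrightarrow> 0) (at p0 within S)"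
    by (elim Lim_transform_within[OF _ zero_less_one]) auto
qed

text \<open>Completing the square: an exponential weight only shifts the mean, so all exponential
  moments are finite.\<close>

lemma normal_density_mult_exp:
  assumes "\<sigma> > 0"
  shows "normal_density \<mu> \<sigma> x * exp (c * x) =
    exp (c * \<mu> + c\<^sup>2 * \<sigma>\<^sup>2 / 2) * normal_density (\<mu> + c * \<sigma>\<^sup>2) \<sigma> x"
proof -
  have "-(x - \<mu>)\<^sup>2 / (2 * \<sigma>\<^sup>2) + c * x = c * \<mu> + c\<^sup>2 * \<sigma>\<^sup>2 / 2 + -(x - (\<mu> + c * \<sigma>\<^sup>2))\<^sup>2 / (2 * \<sigma>\<^sup>2)"
    using assms by (simp add: field_simps power2_eq_square)
  from arg_cong[OF this, of exp] show ?thesis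
    by (simp only: normal_density_def exp_add mult.assoc) (simp add: mult_ac)
qed

lemma integrable_normal_density_exp:
  "\<sigma> > 0 \<Longrightarrow> integrable lborel (\<lambda>x. normal_density \<mu> \<sigma> x * exp (c * x))"
  by (simp add: normal_density_mult_exp)

text \<open>Near \<open>x\<close> the distribution function is a constant plus an integral over a
  compact interval, and the fundamental theorem of calculus applies.\<close>

lemma has_real_derivative_cdf_density:
  fixes f :: "real \<Rightarrow> real"
  assumes "real_distribution (density lborel (\<lambda>x. ennreal (f x)))"
    and cont: "continuous_on UNIV f" and nonneg: "\<And>x. f x \<ge> 0"
  shows "(cdf (density lborel (\<lambda>x. ennreal (f x))) has_real_derivative f x) (at x)"
proof -
  let ?M = "density lborel (\<lambda>x. ennreal (f x))"
  interpret real_distribution ?M by fact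
  have [measurable]: "f \<in> borel_measurable borel"
    using cont by (rule borel_measurable_continuous_onI)
  have eq: "cdf ?M y = cdf ?M (x - 1) + integral {x-1..y} f" if "y \<in> {x-1..x+1}" for y
  proof (cases "y = x - 1")
    case False
    then have "x - 1 < y" using that by auto
    have i: "set_integrable lborel {x-1..y} f"
      using cont by (intro borel_integrable_atLeastAtMost') (auto intro: continuous_on_subset)
    have diff: "cdf ?M y - cdf ?M (x - 1) = measure ?M {x-1<..y}"
      using \<open>x - 1 < y\<close> by (rule cdf_diff_eq)
    have "emeasure ?M {x-1<..y} = (\<integral>\<^sup>+z. ennreal (f z) * indicator {x-1<..y} z \<partial>lborel)"
      by (simp add: emeasure_density)
    also have "\<dots> = (\<integral>\<^sup>+z. ennreal (indicator {x-1..y} z *\<^sub>R f z) \<partial>lborel)"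
      by (intro nn_integral_cong_AE AE_mp[OF AE_lborel_singleton[of "x-1"] AE_I2])
         (auto simp: indicator_def)
    also have "\<dots> = ennreal (integral {x-1..y} f)"
      using i nonneg unfolding set_integrable_def
      by (subst nn_integral_eq_integral)
         (auto simp: set_borel_integral_eq_integral(2)[OF i, symmetric] set_lebesgue_integral_def)
    finally have "measure ?M {x-1<..y} = integral {x-1..y} f" 
      using i nonneg  by (simp add: measure_def integral_nonneg set_borel_integral_eq_integral(1))
    then show ?thesis using diff by simp
  qed simp
  have "((\<lambda>y. integral {x-1..y} f) has_real_derivative f x) (at x within {x-1..x+1})"
    using cont by (intro integral_has_real_derivative) (auto intro: continuous_on_subset)
  then have "((\<lambda>y. cdf ?M (x - 1) + integral {x-1..y} f) has_real_derivative f x) (at x within {x-1..x+1})"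
    by (auto intro!: derivative_eq_intros)
  then have "(cdf ?M has_real_derivative f x) (at x within {x-1..x+1})"
    by (rule has_field_derivative_transform_within[OF _ zero_less_one])
       (simp, metis eq)
  then show ?thesis
    by (simp add: at_within_Icc_at)
qed

definition std_normal_cdf :: "real \<Rightarrow> real" where
  "std_normal_cdf = cdf std_normal_distribution"

interpretation std_normal: real_distribution std_normal_distribution
  by (rule real_dist_normal_dist)

lemma std_normal_cdf_deriv:
  "(std_normal_cdf has_real_derivative std_normal_density x) (at x)"
  unfolding std_normal_cdf_def
  by (intro has_real_derivative_cdf_density real_dist_normal_dist)
     (auto simp: normal_density_def intro!: continuous_intros)

lemma std_normal_cdf_bounds: "0 \<le> std_normal_cdf x" "std_normal_cdf x \<le> 1"
  by (simp_all add: std_normal_cdf_def std_normal.cdf_nonneg std_normal.cdf_bounded_prob)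

lemma std_normal_cdf_at_top: "(std_normal_cdf \<longlongrightarrow> 1) at_top"
  unfolding std_normal_cdf_def by (rule std_normal.cdf_lim_at_top_prob)

lemma std_normal_cdf_at_bot: "(std_normal_cdf \<longlongrightarrow> 0) at_bot"
  unfolding std_normal_cdf_def by (rule std_normal.cdf_lim_at_bot)

lemma std_normal_cdf_measurable [measurable]: "std_normal_cdf \<in> borel_measurable borel"
  by (intro borel_measurable_continuous_onI continuous_at_imp_continuous_on)
     (auto intro: DERIV_isCont[OF std_normal_cdf_deriv])

lemma std_normal_density_deriv:
  "(std_normal_density has_real_derivative - x * std_normal_density x) (at x)"
  unfolding std_normal_density_def[abs_def]
  by (auto intro!: derivative_eq_intros simp: field_simps)

lemma exp_neg_half_square_mult_le_1: "\<bar>x\<bar> * exp (- x\<^sup>2 / 2) \<le> (1::real)"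
proof -
  have "\<bar>x\<bar> \<le> 1 + x\<^sup>2 / 2"
    using zero_le_power2[of "\<bar>x\<bar> - 1"] by (simp add: power2_eq_square algebra_simps abs_mult_self_eq)
  also have "\<dots> \<le> exp (x\<^sup>2 / 2)" by (rule exp_ge_add_one_self)
  finally show ?thesis by (simp add: exp_minus field_simps)
qed

text \<open>Bounds uniform in \<open>x\<close>, since the arguments inserted later may be unbounded
  in \<open>d\<close>; they supply the dominating functions and the lower bound for the negative
  part of the curvature integrand.\<close>

lemma std_normal_density_le_1: "std_normal_density x \<le> 1"
  and std_normal_density_mult_le_1: "\<bar>x * std_normal_density x\<bar> \<le> 1"
proof -
  have c: "1 / sqrt (2 * pi) \<le> 1" "0 \<le> 1 / sqrt (2 * pi)"
    using pi_gt3 by (auto simp: real_le_rsqrt)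
  show "std_normal_density x \<le> 1"
    unfolding std_normal_density_def using c by (intro mult_le_one) auto
  have "\<bar>x * std_normal_density x\<bar> = 1 / sqrt (2 * pi) * (\<bar>x\<bar> * exp (- x\<^sup>2 / 2))"
    by (simp add: std_normal_density_def abs_mult mult_ac)
  also have "\<dots> \<le> 1" using c(1) by (intro mult_le_one exp_neg_half_square_mult_le_1) simp_all
  finally show "\<bar>x * std_normal_density x\<bar> \<le> 1" .
qed

section \<open>Gaussian tails against squared affine functions of the exponential\<close>

text \<open>The cross term \<open>2 * (b - \<delta>) * v\<close> of the square is nonnegative and is
  dropped. The remaining factor in \<open>v\<close> does not depend on \<open>b\<close>; the square
  root undoes the normalisation of \<open>normal_density 0 \<tau> v\<close>.\<close>

lemma normal_density_tail:
  fixes \<delta> \<tau> :: real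
  assumes "\<tau> > 0" "b \<ge> \<delta>" "v \<ge> 0"
  shows "normal_density \<delta> \<tau> (b + v) \<le> normal_density \<delta> \<tau> b * (sqrt (2 * pi * \<tau>\<^sup>2) * normal_density 0 \<tau> v)"
proof -
  have "(b - \<delta>)\<^sup>2 + v\<^sup>2 \<le> (b + v - \<delta>)\<^sup>2"
    using mult_nonneg_nonneg[of "b - \<delta>" v] assms by (simp add: power2_eq_square algebra_simps)
  then have "((b - \<delta>)\<^sup>2 + v\<^sup>2) / (2 * \<tau>\<^sup>2) \<le> (b + v - \<delta>)\<^sup>2 / (2 * \<tau>\<^sup>2)"
    by (rule divide_right_mono) simp
  then have "- (b + v - \<delta>)\<^sup>2 / (2 * \<tau>\<^sup>2) \<le> - (b - \<delta>)\<^sup>2 / (2 * \<tau>\<^sup>2) + - v\<^sup>2 / (2 * \<tau>\<^sup>2)"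
    by (simp add: add_divide_distrib)
  then have "exp (- (b + v - \<delta>)\<^sup>2 / (2 * \<tau>\<^sup>2)) \<le> exp (- (b - \<delta>)\<^sup>2 / (2 * \<tau>\<^sup>2)) * exp (- v\<^sup>2 / (2 * \<tau>\<^sup>2))"
    by (simp add: exp_add[symmetric])
  then have "1 / sqrt (2 * pi * \<tau>\<^sup>2) * exp (- (b + v - \<delta>)\<^sup>2 / (2 * \<tau>\<^sup>2)) \<le>
      1 / sqrt (2 * pi * \<tau>\<^sup>2) * (exp (- (b - \<delta>)\<^sup>2 / (2 * \<tau>\<^sup>2)) * exp (- v\<^sup>2 / (2 * \<tau>\<^sup>2)))"
    by (intro mult_left_mono) auto
  moreover have "sqrt (2 * pi * \<tau>\<^sup>2) > 0" using assms by simp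
  ultimately show ?thesis by (simp add: normal_density_def)
qed

lemma normal_density_antimono:
  fixes \<delta> \<tau> :: real
  assumes "\<delta> \<le> x" "x \<le> y"
  shows "normal_density \<delta> \<tau> y \<le> normal_density \<delta> \<tau> x"
  using assms unfolding normal_density_def
  by (intro mult_left_mono) (auto intro!: divide_right_mono power_mono)

text \<open>One unit step multiplies the density by a factor that tends to 0 as \<open>b\<close>
  grows; this gain decides the comparison below.\<close>

lemma normal_density_step:
  fixes \<delta> \<tau> :: real
  assumes "\<tau> > 0"
  shows "normal_density \<delta> \<tau> b = normal_density \<delta> \<tau> (b - 1) * exp (- ((2 * (b - \<delta>) - 1) / (2 * \<tau>\<^sup>2)))"
proof -
  have "- (b - \<delta>)\<^sup>2 / (2 * \<tau>\<^sup>2) = - (b - 1 - \<delta>)\<^sup>2 / (2 * \<tau>\<^sup>2) + - ((2 * (b - \<delta>) - 1) / (2 * \<tau>\<^sup>2))"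
    using assms by (simp add: field_simps power2_eq_square)
  then show ?thesis unfolding normal_density_def by (simp only: exp_add mult.assoc)
qed

text \<open>\<open>p * exp x - r\<close> is affine in \<open>exp x\<close>, so it is determined by two of its values.\<close>

lemma exp_affine_interpolation:
  fixes p r b v x :: real
  assumes "v \<ge> 0" "b - 3 \<le> x" "x \<le> b - 2"
  shows "(p * exp (b + v) - r)\<^sup>2 \<le> 2 * exp 6 * exp (2 * v) * ((p * exp x - r)\<^sup>2 + (p * exp (x + 1) - r)\<^sup>2)"
proof -
  define w where "w = b + v - x"
  \<comment> \<open>\<open>\<beta>\<close> is the barycentric coordinate of
    \<open>exp (b + v)\<close> with respect to \<open>exp x\<close> and \<open>exp (x + 1)\<close>.
    It is at most \<open>exp w \<le> exp (v + 3)\<close>, and squaring this gives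
    \<open>exp 6 * exp (2 * v)\<close>; the factor 2 comes from the square of a sum.\<close>
  define \<beta> where "\<beta> = (exp w - 1) / (exp 1 - 1)"
  have e: "exp (1::real) \<ge> 2" using exp_ge_add_one_self[of 1] by simp
  have w: "0 \<le> w" "w \<le> v + 3" using assms by (auto simp: w_def)
  have \<beta>: "0 \<le> \<beta>" using w e by (auto simp: \<beta>_def)
  have "\<beta> \<le> (exp w - 1) / 1"
    unfolding \<beta>_def using w e by (intro divide_left_mono) auto
  also have "\<dots> \<le> exp w" by simp
  also have "\<dots> \<le> exp (v + 3)" using w(2) by simp
  finally have \<beta>': "\<beta> \<le> exp (v + 3)" .
  have "exp (v + 3) \<ge> 1" using assms by simp
  with \<beta> \<beta>' have "\<bar>\<beta>\<bar> \<le> exp (v + 3)" "\<bar>1 - \<beta>\<bar> \<le> exp (v + 3)" by linarith+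
  then have sq: "\<beta>\<^sup>2 \<le> (exp (v + 3))\<^sup>2" "(1 - \<beta>)\<^sup>2 \<le> (exp (v + 3))\<^sup>2"
    by (simp_all add: power2_le_iff_abs_le)
  have "\<beta> * (exp 1 - 1) = exp w - 1" using e by (simp add: \<beta>_def)
  then have "exp (b + v) = exp x * (1 + \<beta> * (exp 1 - 1))"
    by (simp add: w_def exp_add[symmetric])
  then have "p * exp (b + v) - r = p * (exp x * (1 + \<beta> * (exp 1 - 1))) - r"
    by (simp only:)
  also have "\<dots> = (1 - \<beta>) * (p * exp x - r) + \<beta> * (p * exp (x + 1) - r)"
    by (simp add: exp_add algebra_simps)
  also have "(\<dots>)\<^sup>2 \<le> 2 * ((1 - \<beta>)\<^sup>2 * (p * exp x - r)\<^sup>2 + \<beta>\<^sup>2 * (p * exp (x + 1) - r)\<^sup>2)"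
    using zero_le_power2[of "(1 - \<beta>) * (p * exp x - r) - \<beta> * (p * exp (x + 1) - r)"]
    by (simp only: power2_sum power2_diff power_mult_distrib) simp
  also have "\<dots> \<le> 2 * ((exp (v + 3))\<^sup>2 * (p * exp x - r)\<^sup>2 + (exp (v + 3))\<^sup>2 * (p * exp (x + 1) - r)\<^sup>2)"
    by (intro mult_left_mono add_mono mult_right_mono sq) auto
  also have "\<dots> = 2 * (exp (v + 3))\<^sup>2 * ((p * exp x - r)\<^sup>2 + (p * exp (x + 1) - r)\<^sup>2)"
    by (simp add: algebra_simps)
  also have "(exp (v + 3))\<^sup>2 = exp 6 * exp (2 * v)"
    by (simp add: exp_add[symmetric] power2_eq_square)
  finally show ?thesis by (simp add: mult.assoc)
qed

text \<open>The interpolation is averaged over the node \<open>x\<close> in a unit interval, because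
  an affine function may vanish at a single node. The other node \<open>x + 1\<close> runs through
  the adjacent unit interval, and the two integrals merge into one.\<close>

lemma exp_affine_le_integral:
  fixes p r b v :: real
  assumes "v \<ge> 0"
  shows "(p * exp (b + v) - r)\<^sup>2 \<le>
    2 * exp 6 * exp (2 * v) * (\<integral>x. indicator {b-3..<b-1} x * (p * exp x - r)\<^sup>2 \<partial>lborel)"
proof -
  let ?P = "\<lambda>x. (p * exp x - r)\<^sup>2"
  have int: "integrable lborel (\<lambda>x. indicator {a..<c} x * ?P x)" for a c :: real
  proof -
    have "set_integrable lborel {a..c} ?P"
      by (intro borel_integrable_atLeastAtMost' continuous_intros)
    then have "set_integrable lborel {a..<c} ?P" by (rule set_integrable_subset) auto
    then show ?thesis by (simp add: set_integrable_def)
  qed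
  have int1: "integrable lborel (\<lambda>x. indicator {b-3..<b-2} x * ?P (x + 1))"
    and eq1: "(\<integral>x. indicator {b-3..<b-2} x * ?P (x + 1) \<partial>lborel) = (\<integral>x. indicator {b-2..<b-1} x * ?P x \<partial>lborel)"
  proof -
    have *: "(\<lambda>x. indicator {b-3..<b-2} x * ?P (x + 1)) = (\<lambda>x. indicator {b-2..<b-1} (1 + 1 * x) * ?P (1 + 1 * x))"
      by (auto simp: fun_eq_iff indicator_def add.commute)
    show "integrable lborel (\<lambda>x. indicator {b-3..<b-2} x * ?P (x + 1))"
      unfolding * by (intro lborel_integrable_real_affine int) simp
    show "(\<integral>x. indicator {b-3..<b-2} x * ?P (x + 1) \<partial>lborel) = (\<integral>x. indicator {b-2..<b-1} x * ?P x \<partial>lborel)"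
      unfolding * by (subst (2) lborel_integral_real_affine[of 1 _ 1]) auto
  qed
  have ind: "integrable lborel (indicator {b-3..<b-2} :: real \<Rightarrow> real)"
    by (intro integrable_real_indicator) auto
  have "?P (b + v) = (\<integral>x. indicator {b-3..<b-2} x * ?P (b + v) \<partial>lborel)"
    by simp
  also have "\<dots> \<le> (\<integral>x. 2 * exp 6 * exp (2 * v) * (indicator {b-3..<b-2} x * ?P x + indicator {b-3..<b-2} x * ?P (x + 1)) \<partial>lborel)"
    using exp_affine_interpolation[OF assms]
    by (intro integral_mono integrable_mult_right integrable_mult_left Bochner_Integration.integrable_add int int1 ind)
       (auto simp: indicator_def)
  also have "\<dots> = 2 * exp 6 * exp (2 * v) * ((\<integral>x. indicator {b-3..<b-2} x * ?P x \<partial>lborel) + (\<integral>x. indicator {b-2..<b-1} x * ?P x \<partial>lborel))"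
    using int int1 eq1 by simp
  also have "(\<integral>x. indicator {b-3..<b-2} x * ?P x \<partial>lborel) + (\<integral>x. indicator {b-2..<b-1} x * ?P x \<partial>lborel)
     = (\<integral>x. indicator {b-3..<b-2} x * ?P x + indicator {b-2..<b-1} x * ?P x \<partial>lborel)"
    using int by simp
  also have "\<dots> = (\<integral>x. indicator {b-3..<b-1} x * ?P x \<partial>lborel)"
    by (intro Bochner_Integration.integral_cong) (auto simp: indicator_def)
  finally show ?thesis .
qed

text \<open>Beyond the first point \<open>b\<close> with \<open>s * \<theta> b = 2\<close> the integrand may be negative. There the Gaussian
  weight is smaller than on the interval from \<open>b - 3\<close> to \<open>b - 1\<close> by a factor that tends to \<open>0\<close> as
  \<open>b\<close> grows, while the squared affine factors on both sides are comparable, uniformly in \<open>p\<close>, \<open>r\<close> and \<open>b\<close>.\<close>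

lemma right_half_nonneg:
  fixes \<delta> \<tau> s \<kappa> :: real
  assumes pos: "\<tau> > 0" "s > 0" "\<kappa> \<ge> 0"
  obtains N where "N \<ge> 0"
    "\<And>\<theta> \<omega> p r. \<lbrakk>\<And>x y. 0 \<le> x \<Longrightarrow> 0 \<le> y \<Longrightarrow> \<bar>\<theta> x - \<theta> y\<bar> \<le> \<kappa> * \<bar>x - y\<bar>;
       \<And>x. 0 \<le> x \<Longrightarrow> x \<le> N \<Longrightarrow> s * \<theta> x > 2;
       \<And>x y. 0 \<le> x \<Longrightarrow> x \<le> y \<Longrightarrow> \<omega> y \<le> \<omega> x; \<And>x. 0 \<le> \<omega> x;
       integrable lborel (\<lambda>x. indicator {0..} x * (normal_density \<delta> \<tau> x * (std_normal_density (\<theta> x) * (s * \<theta> x - 1) * ((p * exp x - r)\<^sup>2 * \<omega> x))))\<rbrakk>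
     \<Longrightarrow> 0 \<le> (\<integral>x. indicator {0..} x * (normal_density \<delta> \<tau> x * (std_normal_density (\<theta> x) * (s * \<theta> x - 1) * ((p * exp x - r)\<^sup>2 * \<omega> x))) \<partial>lborel)"
proof -
  \<comment> \<open>\<open>C\<close> collects everything lost beyond \<open>b\<close>, with
    \<open>K\<close> the exponential moment of the Gaussian tail. \<open>c1\<close> bounds
    \<open>\<phi> (\<theta> x)\<close> from below within distance 3 to the left of \<open>b\<close>,
    where \<open>\<theta>\<close> lies between 0 and \<open>2 / s + 3 * \<kappa>\<close>.\<close>
  define c0 K C c1 where "c0 = sqrt (2 * pi * \<tau>\<^sup>2)"
    and "K = (\<integral>v. normal_density 0 \<tau> v * exp (2 * v) \<partial>lborel)"
    and "C = (1 + s) * (2 * exp 6 * (c0 * K))"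
    and "c1 = std_normal_density (2 / s + 3 * \<kappa>)"
  have int_K: "integrable lborel (\<lambda>v. normal_density 0 \<tau> v * exp (2 * v))"
    by (rule integrable_normal_density_exp[OF pos(1)])
  have c1: "c1 > 0" unfolding c1_def by (rule normal_density_pos) simp
  have c0: "c0 > 0" using pos by (simp add: c0_def)
  have K: "K \<ge> 0" unfolding K_def by (intro integral_nonneg_AE AE_I2) simp
  have C: "C \<ge> 0" using pos c0 K by (simp add: C_def)
  \<comment> \<open>For \<open>b > N\<close> the three entries ensure, in turn, that the interval
    from \<open>b - 3\<close> lies in the positive half-line, that it lies to the right of the mean,
    and that the unit step of the density outweighs \<open>C / c1\<close>.\<close>
  define N where "N = max 3 (max (\<delta> + 3) (\<delta> + 1 / 2 + \<tau>\<^sup>2 * (C / c1)))"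
  have "N \<ge> 0" by (simp add: N_def)
  moreover have "0 \<le> (\<integral>x. indicator {0..} x * (normal_density \<delta> \<tau> x * (std_normal_density (\<theta> x) * (s * \<theta> x - 1) * ((p * exp x - r)\<^sup>2 * \<omega> x))) \<partial>lborel)"
    (is "0 \<le> (\<integral>x. ?g x \<partial>lborel)")
    if lip: "\<And>x y. 0 \<le> x \<Longrightarrow> 0 \<le> y \<Longrightarrow> \<bar>\<theta> x - \<theta> y\<bar> \<le> \<kappa> * \<bar>x - y\<bar>"
      and start: "\<And>x. 0 \<le> x \<Longrightarrow> x \<le> N \<Longrightarrow> s * \<theta> x > 2"
      and \<omega>: "\<And>x y. 0 \<le> x \<Longrightarrow> x \<le> y \<Longrightarrow> \<omega> y \<le> \<omega> x" "\<And>x. 0 \<le> \<omega> x"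
      and int: "integrable lborel (\<lambda>x. indicator {0..} x * (normal_density \<delta> \<tau> x * (std_normal_density (\<theta> x) * (s * \<theta> x - 1) * ((p * exp x - r)\<^sup>2 * \<omega> x))))"
    for \<theta> \<omega> :: "real \<Rightarrow> real" and p r :: real
  proof (cases "\<exists>x\<ge>0. s * \<theta> x \<le> 2")
    case False
    have "?g x \<ge> 0" for x
    proof (cases "x \<ge> 0")
      case True
      with False have "s * \<theta> x - 1 \<ge> 0" by force
      then show ?thesis by (intro mult_nonneg_nonneg \<omega>) auto
    qed simp
    then show ?thesis by (intro integral_nonneg_AE AE_I2)
  next
    case True
    \<comment> \<open>The threshold is 2, although the sign can change only at 1, so that
      \<open>s * \<theta> x - 1\<close> is at least 1 before \<open>b\<close>. Closedness puts the
      infimum itself into \<open>bad\<close>, which bounds \<open>\<theta> b\<close> from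
      above.\<close>
    define bad where "bad = {0..} \<inter> (\<lambda>x. s * \<theta> x) -` {..2}"
    define b where "b = Inf bad"
    have "\<kappa>-lipschitz_on {0..} \<theta>"
      using lip pos by (auto simp: lipschitz_on_def dist_real_def)
    then have "continuous_on {0..} \<theta>" by (rule lipschitz_on_continuous_on)
    then have "closed bad" unfolding bad_def
      by (intro continuous_closed_preimage continuous_intros) auto
    moreover have ne: "bad \<noteq> {}" and bdd: "bdd_below bad"
      using True by (auto simp: bad_def intro!: bdd_belowI[of _ 0])
    ultimately have "b \<in> bad" unfolding b_def by (intro closed_contains_Inf)
    then have b: "b \<ge> 0" "s * \<theta> b \<le> 2" by (auto simp: bad_def)
    have before: "s * \<theta> x > 2" if "0 \<le> x" "x < b" for x
    proof (rule ccontr)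
      assume "\<not> s * \<theta> x > 2"
      then have "x \<in> bad" using that by (auto simp: bad_def)
      then have "b \<le> x" unfolding b_def using bdd by (rule cInf_lower)
      then show False using that by simp
    qed
    have "b > N" using start[of b] b by (cases "b \<le> N") auto
    then have bN: "b > 3" "b > \<delta> + 3" "b > \<delta> + 1 / 2 + \<tau>\<^sup>2 * (C / c1)" by (auto simp: N_def)
    \<comment> \<open>By monotonicity the single value \<open>W\<close> bounds
      \<open>\<omega>\<close> from below on the good interval and from above beyond
      \<open>b\<close>; it thus factors out of the comparison, as does \<open>E\<close>.\<close>
    define W E where "W = \<omega> (b - 1)"
      and "E = (\<integral>x. indicator {b-3..<b-1} x * (p * exp x - r)\<^sup>2 \<partial>lborel)"
    have W: "W \<ge> 0" using \<omega> by (simp add: W_def)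
    have E: "E \<ge> 0" unfolding E_def by (intro integral_nonneg_AE AE_I2) simp
    have int_E: "integrable lborel (\<lambda>x. indicator {b-3..<b-1} x * (p * exp x - r)\<^sup>2)"
    proof -
      have "set_integrable lborel {b-3..b-1} (\<lambda>x. (p * exp x - r)\<^sup>2)"
        by (intro borel_integrable_atLeastAtMost' continuous_intros)
      then have "set_integrable lborel {b-3..<b-1} (\<lambda>x. (p * exp x - r)\<^sup>2)" by (rule set_integrable_subset) auto
      then show ?thesis by (simp add: set_integrable_def)
    qed
    \<comment> \<open>\<open>neg\<close> is subtracted on the whole line, not only beyond
      \<open>b\<close>: it is nonnegative, so the minorant \<open>low\<close> remains valid, and its
      integral is an explicit multiple of \<open>K\<close> by translation.\<close>
    define neg where "neg x = W * ((1 + s) * (2 * exp 6) * E * normal_density \<delta> \<tau> b * c0 * (normal_density 0 \<tau> (x - b) * exp (2 * (x - b))))" for x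
    define low where "low x = W * (c1 * normal_density \<delta> \<tau> (b - 1) * (indicator {b-3..<b-1} x * (p * exp x - r)\<^sup>2))
      - neg x" for x
    have int_shift: "integrable lborel (\<lambda>x. normal_density 0 \<tau> (x - b) * exp (2 * (x - b)))"
      and shift: "(\<integral>x. normal_density 0 \<tau> (x - b) * exp (2 * (x - b)) \<partial>lborel) = K"
      using lborel_integrable_real_affine[OF int_K, of 1 "-b"]
        lborel_integral_real_affine[of 1 "\<lambda>v. normal_density 0 \<tau> v * exp (2 * v)" "-b"]
      by (simp_all add: K_def)
    have "low x \<le> ?g x" for x
    proof -
      have second: "0 \<le> neg x"
        unfolding neg_def
        using W E c0 pos by (intro mult_nonneg_nonneg) auto
      consider "x < 0" | "0 \<le> x" "x < b" "x \<notin> {b-3..<b-1}" | "x \<in> {b-3..<b-1}" | "x \<ge> b" by force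
      then show ?thesis
      proof cases
        case 1
        then show ?thesis using second bN by (simp add: low_def)
      next
        case 2
        then have "?g x \<ge> 0" using before[of x] \<omega>(2) by (auto intro!: mult_nonneg_nonneg)
        then show ?thesis using second 2 by (simp add: low_def)
      next
        case 3
        then have x: "0 \<le> x" "x < b" "x \<le> b - 1" using bN by auto
        have "\<bar>\<theta> x - \<theta> b\<bar> \<le> \<kappa> * \<bar>x - b\<bar>" using lip[of x b] x b by simp
        also have "\<dots> \<le> \<kappa> * 3" using 3 x pos by (intro mult_left_mono) auto
        finally have "\<bar>\<theta> x - \<theta> b\<bar> \<le> \<kappa> * 3" .
        moreover have "\<theta> b \<le> 2 / s" using b pos by (simp add: field_simps)
        ultimately have "\<theta> x \<le> 2 / s + 3 * \<kappa>" by linarith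
        moreover have "\<theta> x \<ge> 0" using before[OF x(1,2)] pos by (simp add: less_imp_le zero_less_mult_pos[of s "\<theta> x"])
        ultimately have "c1 \<le> std_normal_density (\<theta> x)"
          unfolding c1_def by (intro normal_density_antimono)
        moreover have "normal_density \<delta> \<tau> (b - 1) \<le> normal_density \<delta> \<tau> x"
          using x 3 bN by (intro normal_density_antimono) auto
        moreover have "W \<le> \<omega> x" using \<omega>(1)[OF x(1,3)] by (simp add: W_def)
        moreover have "1 \<le> s * \<theta> x - 1" using before[OF x(1,2)] by simp
        ultimately have "normal_density \<delta> \<tau> (b - 1) * (c1 * 1 * ((p * exp x - r)\<^sup>2 * W)) \<le>
            normal_density \<delta> \<tau> x * (std_normal_density (\<theta> x) * (s * \<theta> x - 1) * ((p * exp x - r)\<^sup>2 * \<omega> x))"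
          using c1 W by (intro mult_mono mult_nonneg_nonneg) auto
        then show ?thesis using second 3 x by (simp add: low_def mult_ac)
      next
        case 4
        define v where "v = x - b"
        have v: "v \<ge> 0" "x = b + v" using 4 by (auto simp: v_def)
        have x: "0 \<le> x" "b - 1 \<le> x" "x \<notin> {b-3..<b-1}" "0 \<le> b - 1" using 4 bN by auto
        \<comment> \<open>Beyond \<open>b\<close> nothing is known about the sign or size of
          \<open>\<theta> x\<close>, so a bound valid for all arguments is used.\<close>
        have "\<bar>std_normal_density (\<theta> x) * (s * \<theta> x - 1)\<bar> \<le> s * \<bar>\<theta> x * std_normal_density (\<theta> x)\<bar> + \<bar>std_normal_density (\<theta> x)\<bar>"
          using pos by (simp add: algebra_simps abs_mult order_trans[OF abs_triangle_ineq4])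
        also have "\<dots> \<le> s * 1 + 1"
          using pos by (intro add_mono mult_left_mono std_normal_density_mult_le_1)
            (auto simp: std_normal_density_le_1)
        finally have "- (1 + s) \<le> std_normal_density (\<theta> x) * (s * \<theta> x - 1)" by linarith
        then have lo: "- (1 + s) * (normal_density \<delta> \<tau> x * (p * exp x - r)\<^sup>2 * \<omega> x) \<le>
            std_normal_density (\<theta> x) * (s * \<theta> x - 1) * (normal_density \<delta> \<tau> x * (p * exp x - r)\<^sup>2 * \<omega> x)"
          using \<omega>(2) by (intro mult_right_mono) auto
        have hi: "normal_density \<delta> \<tau> x * (p * exp x - r)\<^sup>2 * \<omega> x \<le>
            (normal_density \<delta> \<tau> b * (c0 * normal_density 0 \<tau> v)) * (2 * exp 6 * exp (2 * v) * E) * W"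
          unfolding v(2) c0_def E_def W_def
          using v(1) bN pos(1) x \<omega> 
          by (intro mult_mono normal_density_tail exp_affine_le_integral mult_nonneg_nonneg \<omega>(1)
              integral_nonneg_AE AE_I2) (auto simp: v(2))
        have "- (1 + s) * ((normal_density \<delta> \<tau> b * (c0 * normal_density 0 \<tau> v)) * (2 * exp 6 * exp (2 * v) * E) * W)
            \<le> std_normal_density (\<theta> x) * (s * \<theta> x - 1) * (normal_density \<delta> \<tau> x * (p * exp x - r)\<^sup>2 * \<omega> x)"
          using pos by (intro order_trans[OF mult_left_mono_neg[OF hi] lo]) simp
        then show ?thesis using x v by (simp add: low_def neg_def mult_ac del: minus_add_distrib add_uminus_conv_diff)
      qed
    qed
    moreover have "integrable lborel low"
      unfolding low_def neg_def
      by (intro Bochner_Integration.integrable_diff integrable_mult_right int_E int_shift)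
    ultimately have "(\<integral>x. low x \<partial>lborel) \<le> (\<integral>x. ?g x \<partial>lborel)"
      using int by (intro integral_mono) auto
    moreover have "(\<integral>x. low x \<partial>lborel) = W * E * (c1 * normal_density \<delta> \<tau> (b - 1) - C * normal_density \<delta> \<tau> b)"
      unfolding low_def neg_def
      by (subst Bochner_Integration.integral_diff)
         (use int_E int_shift in \<open>simp_all only: integral_mult_right_zero shift E_def[symmetric] integrable_mult_right\<close>,
           simp add: C_def algebra_simps)
    moreover have "C * normal_density \<delta> \<tau> b \<le> c1 * normal_density \<delta> \<tau> (b - 1)"
    proof -
      let ?x = "(2 * (b - \<delta>) - 1) / (2 * \<tau>\<^sup>2)"
      have "C / c1 \<le> ?x" using bN(3) pos by (simp add: field_simps)
      also have "?x \<le> exp ?x" using exp_ge_add_one_self[of ?x] by linarith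
      finally have "C * exp (- ?x) \<le> c1" using c1 by (simp add: exp_minus field_simps)
      then have "(C * exp (- ?x)) * normal_density \<delta> \<tau> (b - 1) \<le> c1 * normal_density \<delta> \<tau> (b - 1)"
        by (intro mult_right_mono) auto
      then show ?thesis by (subst normal_density_step[OF pos(1)]) (simp add: mult_ac)
    qed
    ultimately show ?thesis using mult_nonneg_nonneg[OF mult_nonneg_nonneg[OF W E], of "c1 * normal_density \<delta> \<tau> (b - 1) - C * normal_density \<delta> \<tau> b"]
      by linarith
  qed
  ultimately show thesis using that by blast
qed

section \<open>The mixture and its level curves\<close>

text \<open>Covers both orders of \<open>a\<close> and \<open>b\<close> and their equality; the
  bound on \<open>\<xi>\<close> later squeezes the intermediate point of a level difference to its
  limit.\<close>

lemma mvt_real_two_sided: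
  fixes f :: "real \<Rightarrow> real"
  assumes "\<And>x. (f has_real_derivative f' x) (at x)"
  shows "\<exists>\<xi>. \<bar>\<xi> - a\<bar> \<le> \<bar>b - a\<bar> \<and> f b - f a = (b - a) * f' \<xi>"
proof (cases a b rule: linorder_cases)
  case less
  obtain z where "a < z" "z < b" "f b - f a = (b - a) * f' z"
    using MVT2[OF less, of f f'] assms by blast
  then show ?thesis by (intro exI[of _ z]) auto
next
  case greater
  obtain z where "b < z" "z < a" "f a - f b = (a - b) * f' z"
    using MVT2[OF greater, of f f'] assms by blast
  then show ?thesis by (intro exI[of _ z]) (auto simp: algebra_simps)
qed auto

text \<open>In this locale \<open>\<psi>\<close> is the density of \<open>d = Z$j - Z$i\<close>, and \<open>Z$i\<close> given \<open>d\<close> is normal with mean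
  \<open>m + k * d\<close> and standard deviation \<open>1 / s\<close>. Then \<open>F l t\<close> is the probability of
  \<open>X$i + t * X$j \<le> exp l\<close>.\<close>

locale gauss_mix =
  fixes \<delta> \<tau> s m k :: real
  assumes \<tau>: "\<tau> > 0" and s: "s > 0"
begin

abbreviation \<psi> :: "real \<Rightarrow> real" where "\<psi> \<equiv> normal_density \<delta> \<tau>"
abbreviation \<phi> :: "real \<Rightarrow> real" where "\<phi> \<equiv> std_normal_density"

definition arg :: "real \<Rightarrow> real \<Rightarrow> real \<Rightarrow> real" where
  "arg l t d = s * (l - ln (1 + t * exp d) - m - k * d)"

definition slope :: "real \<Rightarrow> real \<Rightarrow> real" where
  "slope t d = exp d / (1 + t * exp d)"

definition F :: "real \<Rightarrow> real \<Rightarrow> real" where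
  "F l t = (\<integral>d. \<psi> d * std_normal_cdf (arg l t d) \<partial>lborel)"

text \<open>The family is suited to differentiation: the derivative of \<open>\<phi>\<close> brings
  down a factor \<open>arg\<close>, and derivatives in \<open>t\<close> bring down factors
  \<open>slope\<close>. Two derivatives of \<open>F\<close> require only
  \<open>i \<le> 1\<close>.\<close>

definition moment :: "nat \<Rightarrow> nat \<Rightarrow> real \<Rightarrow> real \<Rightarrow> real" where
  "moment i j l t = (\<integral>d. \<psi> d * (\<phi> (arg l t d) * arg l t d ^ i * slope t d ^ j) \<partial>lborel)"

lemma measurable_arg [measurable]: "arg l t \<in> borel_measurable borel"
  unfolding arg_def[abs_def] by measurable

lemma measurable_slope [measurable]: "slope t \<in> borel_measurable borel"
  unfolding slope_def[abs_def] by measurable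

text \<open>The bound \<open>exp d\<close> is uniform in \<open>t \<ge> 0\<close>, so one dominating
  function serves up to and including \<open>t = 0\<close>.\<close>

lemma slope_bounds:
  assumes "t \<ge> 0" shows "0 < slope t d" "slope t d \<le> exp d"
proof -
  have "1 + t * exp d \<ge> 1" using assms by simp
  then show "0 < slope t d" "slope t d \<le> exp d"
    by (auto simp: slope_def divide_simps intro!: mult_right_le_one_le)
qed

lemma \<phi>_power_le_1: "i \<le> 1 \<Longrightarrow> \<bar>\<phi> x * x ^ i\<bar> \<le> 1"
  using std_normal_density_le_1[of x] std_normal_density_mult_le_1[of x]
  by (cases i) (auto simp: mult.commute)

lemma integrable_exp: "integrable lborel (\<lambda>d. \<psi> d * exp d ^ j)"
  using integrable_normal_density_exp[OF \<tau>, of \<delta> "real j"]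
  by (simp add: exp_of_nat_mult)

lemma integrable_cdf_arg: "integrable lborel (\<lambda>d. \<psi> d * std_normal_cdf (arg l t d))"
  by (rule Bochner_Integration.integrable_bound[OF integrable_exp[of 0]])
     (auto simp: abs_mult std_normal_cdf_bounds intro!: mult_right_le_one_le)

lemma slope_power_le: "t \<ge> 0 \<Longrightarrow> \<bar>slope t d ^ j\<bar> \<le> exp d ^ j"
  using slope_bounds[of t d] by (simp add: power_abs[symmetric] power_mono)

lemma integrable_moment:
  assumes "t \<ge> 0" "i \<le> 1"
  shows "integrable lborel (\<lambda>d. \<psi> d * (\<phi> (arg l t d) * arg l t d ^ i * slope t d ^ j))"
proof (rule Bochner_Integration.integrable_bound[OF integrable_exp[of j]])
  show "AE d in lborel. norm (\<psi> d * (\<phi> (arg l t d) * arg l t d ^ i * slope t d ^ j)) \<le> norm (\<psi> d * exp d ^ j)"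
  proof (rule AE_I2)
    fix d
    have "\<bar>\<phi> (arg l t d) * arg l t d ^ i\<bar> * \<bar>slope t d ^ j\<bar> \<le> 1 * exp d ^ j"
      using assms by (intro mult_mono \<phi>_power_le_1 slope_power_le) auto
    then show "norm (\<psi> d * (\<phi> (arg l t d) * arg l t d ^ i * slope t d ^ j)) \<le> norm (\<psi> d * exp d ^ j)"
      by (simp add: abs_mult mult_left_mono)
  qed
qed simp

section \<open>Derivatives of the mixture and of its moments, one-sided at weight zero\<close>

lemma arg_derivative:
  assumes "snd p \<ge> 0"
  shows "((\<lambda>p. arg (fst p) (snd p) d) has_derivative
    (\<lambda>h. s * (fst h - slope (snd p) d * snd h))) (at p within S)"
proof -
  have "1 + snd p * exp d > 0" using assms by (simp add: add_pos_nonneg)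
  then show ?thesis unfolding arg_def slope_def
    by (auto intro!: derivative_eq_intros simp: field_simps)
qed

lemma slope_derivative:
  assumes "snd p \<ge> 0"
  shows "((\<lambda>p. slope (snd p) d) has_derivative (\<lambda>h. - (slope (snd p) d)\<^sup>2 * snd h)) (at p within S)"
proof -
  have "1 + snd p * exp d > 0" using assms by (simp add: add_pos_nonneg)
  then show ?thesis unfolding slope_def
    by (auto intro!: derivative_eq_intros simp: field_simps power2_eq_square)
qed

lemma fst_snd_le_norm: "\<bar>fst h\<bar> \<le> norm h" "\<bar>snd h\<bar> \<le> norm h" for h :: "real \<times> real"
  using norm_fst_le[of "fst h" "snd h"] norm_snd_le[of "snd h" "fst h"] by simp_all

lemma F_derivative:
  assumes "t \<ge> 0"
  shows "((\<lambda>p. F (fst p) (snd p)) has_derivative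
    (\<lambda>h. s * moment 0 0 l t * fst h - s * moment 0 1 l t * snd h)) (at (l, t) within UNIV \<times> {0..})"
proof -
  define f' where "f' p d h = \<psi> d * (s * (fst h - slope (snd p) d * snd h) * \<phi> (arg (fst p) (snd p) d))"
    for p h :: "real \<times> real" and d
  have split: "f' (l, t) d h = (s * fst h) * (\<psi> d * (\<phi> (arg l t d) * arg l t d ^ 0 * slope t d ^ 0))
     - (s * snd h) * (\<psi> d * (\<phi> (arg l t d) * arg l t d ^ 0 * slope t d ^ 1))" for d h
    by (simp add: f'_def algebra_simps)
  have "((\<lambda>p. F (fst p) (snd p)) has_derivative (\<lambda>h. \<integral>d. f' (l, t) d h \<partial>lborel)) (at (l, t) within UNIV \<times> {0..})"
    unfolding F_def
  proof (rule has_derivative_integral_dominated[where B="\<lambda>d. s * (\<psi> d * exp d ^ 0 + \<psi> d * exp d ^ 1)"])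
    fix p :: "real \<times> real" assume p: "p \<in> UNIV \<times> {0..}"
    show "integrable lborel (\<lambda>d. \<psi> d * std_normal_cdf (arg (fst p) (snd p) d))"
      by (rule integrable_cdf_arg)
  next
    fix h show "integrable lborel (\<lambda>d. f' (l, t) d h)"
      unfolding split using assms
      by (intro Bochner_Integration.integrable_diff integrable_mult_right integrable_moment) auto
  next
    fix p :: "real \<times> real" and d assume p: "p \<in> UNIV \<times> {0..}"
    then have "((\<lambda>p. std_normal_cdf (arg (fst p) (snd p) d)) has_derivative
       (\<lambda>h. s * (fst h - slope (snd p) d * snd h) * \<phi> (arg (fst p) (snd p) d))) (at p within UNIV \<times> {0..})"
      by (intro DERIV_compose_FDERIV std_normal_cdf_deriv arg_derivative) auto
    then show "((\<lambda>p. \<psi> d * std_normal_cdf (arg (fst p) (snd p) d)) has_derivative f' p d) (at p within UNIV \<times> {0..})"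
      unfolding f'_def by (rule has_derivative_mult_right)
  next
    fix p h :: "real \<times> real" and d assume p: "p \<in> UNIV \<times> {0..}"
    have "\<bar>fst h - slope (snd p) d * snd h\<bar> \<le> \<bar>fst h\<bar> + \<bar>slope (snd p) d\<bar> * \<bar>snd h\<bar>"
      by (simp add: abs_mult[symmetric])
    also have "\<dots> \<le> norm h + exp d * norm h"
      using slope_bounds[of "snd p" d] p fst_snd_le_norm[of h] by (intro add_mono mult_mono) auto
    finally have "\<bar>fst h - slope (snd p) d * snd h\<bar> * \<phi> (arg (fst p) (snd p) d) \<le> (norm h + exp d * norm h) * 1"
      by (intro mult_mono std_normal_density_le_1) auto
    then have "\<psi> d * (s * (\<bar>fst h - slope (snd p) d * snd h\<bar> * \<phi> (arg (fst p) (snd p) d))) \<le> \<psi> d * (s * (norm h + exp d * norm h))"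
      using s by (intro mult_left_mono) auto
    moreover have "\<bar>f' p d h\<bar> = \<psi> d * (s * (\<bar>fst h - slope (snd p) d * snd h\<bar> * \<phi> (arg (fst p) (snd p) d)))"
      using s by (simp add: f'_def abs_mult)
    moreover have "\<psi> d * (s * (norm h + exp d * norm h)) = s * (\<psi> d * exp d ^ 0 + \<psi> d * exp d ^ 1) * norm h"
      by (simp add: algebra_simps)
    ultimately show "\<bar>f' p d h\<bar> \<le> s * (\<psi> d * exp d ^ 0 + \<psi> d * exp d ^ 1) * norm h" by simp
  qed (use assms integrable_exp[of 0] integrable_exp[of 1] in
      \<open>auto intro!: convex_Times Bochner_Integration.integrable_add integrable_mult_right\<close>)
  moreover have "(\<integral>d. f' (l, t) d h \<partial>lborel) = s * moment 0 0 l t * fst h - s * moment 0 1 l t * snd h" for h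
    unfolding split moment_def using integrable_moment[OF assms, of 0 l 0] integrable_moment[OF assms, of 0 l 1]
    by (simp del: power_0 power_one_right power_Suc)
  ultimately show ?thesis by simp
qed

text \<open>\<open>\<phi>' x = - x * \<phi> x\<close> raises the first index, while the
  \<open>t\<close>-derivative of \<open>slope\<close>, minus its square, raises the second. Joint
  differentiability in \<open>(l, t)\<close> is what the chain rule along
  \<open>t \<mapsto> (L t, t)\<close> needs.\<close>

lemma moment_derivative:
  assumes "t \<ge> 0"
  shows "((\<lambda>p. moment 0 j (fst p) (snd p)) has_derivative
    (\<lambda>h. (s * moment 1 (Suc j) l t - real j * moment 0 (Suc j) l t) * snd h - s * moment 1 j l t * fst h))
    (at (l, t) within UNIV \<times> {0..})"
proof -
  define f' where "f' p d h = \<psi> d * (\<phi> (arg (fst p) (snd p) d) * (real j * (- (slope (snd p) d)\<^sup>2 * snd h) * slope (snd p) d ^ (j - 1))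
      + s * (fst h - slope (snd p) d * snd h) * (- arg (fst p) (snd p) d * \<phi> (arg (fst p) (snd p) d)) * slope (snd p) d ^ j)"
    for p h :: "real \<times> real" and d
  \<comment> \<open>For \<open>j = 0\<close> the truncated exponent \<open>j - 1\<close> does no
    harm, because the factor \<open>real j\<close> vanishes.\<close>
  have pow: "real j * (x\<^sup>2 * x ^ (j - 1)) = real j * x ^ Suc j" for x :: real
    by (cases j) (auto simp: power2_eq_square)
  have split: "f' p d h = 
      snd h * (s * (\<psi> d * (\<phi> (arg (fst p) (snd p) d) * arg (fst p) (snd p) d ^ 1 * slope (snd p) d ^ Suc j))
        - real j * (\<psi> d * (\<phi> (arg (fst p) (snd p) d) * arg (fst p) (snd p) d ^ 0 * slope (snd p) d ^ Suc j)))
      - (s * fst h) * (\<psi> d * (\<phi> (arg (fst p) (snd p) d) * arg (fst p) (snd p) d ^ 1 * slope (snd p) d ^ j))" for p d h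
  proof -
    have "f' p d h = - (\<psi> d * \<phi> (arg (fst p) (snd p) d) * snd h * (real j * ((slope (snd p) d)\<^sup>2 * slope (snd p) d ^ (j - 1))))
      - \<psi> d * (s * (fst h - slope (snd p) d * snd h) * (arg (fst p) (snd p) d * \<phi> (arg (fst p) (snd p) d)) * slope (snd p) d ^ j)"
      by (simp add: f'_def algebra_simps)
    then show ?thesis unfolding pow by (simp add: algebra_simps)
  qed
  have "((\<lambda>p. moment 0 j (fst p) (snd p)) has_derivative (\<lambda>h. \<integral>d. f' (l, t) d h \<partial>lborel)) (at (l, t) within UNIV \<times> {0..})"
    unfolding moment_def
  proof (rule has_derivative_integral_dominated[where B="\<lambda>d. (s + real j) * (\<psi> d * exp d ^ Suc j) + s * (\<psi> d * exp d ^ j)"])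
    fix p :: "real \<times> real" assume p: "p \<in> UNIV \<times> {0..}"
    then show "integrable lborel (\<lambda>d. \<psi> d * (\<phi> (arg (fst p) (snd p) d) * arg (fst p) (snd p) d ^ 0 * slope (snd p) d ^ j))"
      by (intro integrable_moment) auto
  next
    fix h show "integrable lborel (\<lambda>d. f' (l, t) d h)"
      unfolding split fst_conv snd_conv using assms
      by (intro Bochner_Integration.integrable_diff integrable_mult_right integrable_moment) auto
  next
    fix p :: "real \<times> real" and d assume p: "p \<in> UNIV \<times> {0..}"
    then have "((\<lambda>p. \<phi> (arg (fst p) (snd p) d)) has_derivative
       (\<lambda>h. s * (fst h - slope (snd p) d * snd h) * (- arg (fst p) (snd p) d * \<phi> (arg (fst p) (snd p) d)))) (at p within UNIV \<times> {0..})"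
      by (intro DERIV_compose_FDERIV std_normal_density_deriv arg_derivative) auto
    moreover have "((\<lambda>p. slope (snd p) d ^ j) has_derivative
       (\<lambda>h. real j * (- (slope (snd p) d)\<^sup>2 * snd h) * slope (snd p) d ^ (j - 1))) (at p within UNIV \<times> {0..})"
      using p by (intro has_derivative_power slope_derivative) auto
    ultimately have "((\<lambda>p. \<phi> (arg (fst p) (snd p) d) * slope (snd p) d ^ j) has_derivative
       (\<lambda>h. \<phi> (arg (fst p) (snd p) d) * (real j * (- (slope (snd p) d)\<^sup>2 * snd h) * slope (snd p) d ^ (j - 1))
      + s * (fst h - slope (snd p) d * snd h) * (- arg (fst p) (snd p) d * \<phi> (arg (fst p) (snd p) d)) * slope (snd p) d ^ j)) (at p within UNIV \<times> {0..})"
      by (rule has_derivative_mult)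
    then show "((\<lambda>p. \<psi> d * (\<phi> (arg (fst p) (snd p) d) * arg (fst p) (snd p) d ^ 0 * slope (snd p) d ^ j)) has_derivative f' p d) (at p within UNIV \<times> {0..})"
      unfolding f'_def power_0 mult_1_right by (rule has_derivative_mult_right)
  next
    fix p h :: "real \<times> real" and d assume p: "p \<in> UNIV \<times> {0..}"
    define A where "A i n = \<psi> d * (\<phi> (arg (fst p) (snd p) d) * arg (fst p) (snd p) d ^ i * slope (snd p) d ^ n)" for i n
    have A: "\<bar>A i n\<bar> \<le> \<psi> d * exp d ^ n" if "i \<le> 1" for i n
    proof -
      have "\<bar>\<phi> (arg (fst p) (snd p) d) * arg (fst p) (snd p) d ^ i\<bar> * \<bar>slope (snd p) d ^ n\<bar> \<le> 1 * exp d ^ n"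
        using p that by (intro mult_mono \<phi>_power_le_1 slope_power_le) auto
      then show ?thesis by (simp add: A_def abs_mult mult_left_mono)
    qed
    have "\<bar>f' p d h\<bar> \<le> \<bar>snd h\<bar> * (s * \<bar>A 1 (Suc j)\<bar> + real j * \<bar>A 0 (Suc j)\<bar>) + s * \<bar>fst h\<bar> * \<bar>A 1 j\<bar>"
    proof -
      have "\<bar>f' p d h\<bar> \<le> \<bar>snd h * (s * A 1 (Suc j) - real j * A 0 (Suc j))\<bar> + \<bar>s * fst h * A 1 j\<bar>"
        unfolding split A_def by (rule abs_triangle_ineq4)
      also have "\<dots> \<le> \<bar>snd h\<bar> * (\<bar>s * A 1 (Suc j)\<bar> + \<bar>real j * A 0 (Suc j)\<bar>) + \<bar>s * fst h * A 1 j\<bar>"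
        by (simp only: abs_mult[of "snd h"]) (intro add_mono mult_left_mono abs_triangle_ineq4, auto)
      finally show ?thesis using s by (simp add: abs_mult)
    qed
    also have "\<dots> \<le> norm h * (s * (\<psi> d * exp d ^ Suc j) + real j * (\<psi> d * exp d ^ Suc j)) + s * norm h * (\<psi> d * exp d ^ j)"
      using s by (intro add_mono mult_mono A fst_snd_le_norm add_nonneg_nonneg mult_nonneg_nonneg) auto
    finally show "\<bar>f' p d h\<bar> \<le> ((s + real j) * (\<psi> d * exp d ^ Suc j) + s * (\<psi> d * exp d ^ j)) * norm h"
      by (simp add: algebra_simps)
  qed (use assms in \<open>auto intro!: convex_Times Bochner_Integration.integrable_add integrable_mult_right integrable_exp simp del: power_Suc\<close>)
  moreover have "(\<integral>d. f' (l, t) d h \<partial>lborel) = (s * moment 1 (Suc j) l t - real j * moment 0 (Suc j) l t) * snd h - s * moment 1 j l t * fst h" for h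
  proof -
    have i: "integrable lborel (\<lambda>d. \<psi> d * (\<phi> (arg l t d) * arg l t d ^ i * slope t d ^ n))" if "i \<le> 1" for i n
      using integrable_moment[OF assms that] .
    show ?thesis unfolding split fst_conv snd_conv moment_def
      using i[of 0 "Suc j"] i[of 1 "Suc j"] i[of 1 j] by (simp del: power_0 power_one_right power_Suc)
  qed
  ultimately show ?thesis by simp
qed

lemma F_deriv_level:
  assumes "t \<ge> 0"
  shows "((\<lambda>l. F l t) has_real_derivative s * moment 0 0 l t) (at l)"
proof -
  have "((\<lambda>l. (l, t)) has_derivative (\<lambda>h. (h, 0))) (at l)"
    by (auto intro!: derivative_eq_intros)
  then have "((\<lambda>p. F (fst p) (snd p)) \<circ> (\<lambda>l. (l, t)) has_derivative
    (\<lambda>h. s * moment 0 0 l t * fst h - s * moment 0 1 l t * snd h) \<circ> (\<lambda>h. (h, 0))) (at l)"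
    using assms
    by (intro diff_chain_within has_derivative_subset[OF F_derivative[OF assms]]) auto
  then show ?thesis
    unfolding has_field_derivative_def comp_def
    by (simp only: fst_conv snd_conv) (erule has_derivative_eq_rhs, simp add: fun_eq_iff)
qed

lemma F_deriv_weight:
  assumes "t \<ge> 0"
  shows "((\<lambda>t. F l t) has_real_derivative - s * moment 0 1 l t) (at t within {0..})"
proof -
  have "((\<lambda>t. (l, t)) has_derivative (\<lambda>h. (0, h))) (at t within {0..})"
    by (auto intro!: derivative_eq_intros)
  then have "((\<lambda>p. F (fst p) (snd p)) \<circ> (\<lambda>t. (l, t)) has_derivative
    (\<lambda>h. s * moment 0 0 l t * fst h - s * moment 0 1 l t * snd h) \<circ> (\<lambda>h. (0, h))) (at t within {0..})"
    using assms
    by (intro diff_chain_within has_derivative_subset[OF F_derivative[OF assms]]) auto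
  then show ?thesis
    unfolding has_field_derivative_def comp_def
    by (simp only: fst_conv snd_conv) (erule has_derivative_eq_rhs, simp add: fun_eq_iff)
qed

section \<open>Strict monotonicity and solvability of the level equation\<close>

lemma moment_pos:
  assumes "t \<ge> 0" shows "moment 0 0 l t > 0"
proof -
  have pos: "\<psi> d * (\<phi> (arg l t d) * arg l t d ^ 0 * slope t d ^ 0) > 0" for d
    using normal_density_pos[OF \<tau>, of \<delta> d] normal_density_pos[of 1 0 "arg l t d"] by simp
  have int: "integrable lborel (\<lambda>d. \<psi> d * (\<phi> (arg l t d) * arg l t d ^ 0 * slope t d ^ 0))"
    using assms by (rule integrable_moment) simp
  have "moment 0 0 l t \<noteq> 0"
  proof
    assume "moment 0 0 l t = 0"
    then have "AE d in lborel. \<psi> d * (\<phi> (arg l t d) * arg l t d ^ 0 * slope t d ^ 0) = 0"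
      unfolding moment_def using int pos
      by (subst (asm) integral_nonneg_eq_0_iff_AE) (auto intro!: AE_I2 less_imp_le)
    then have "AE d in (lborel :: real measure). False"
      by (rule AE_mp) (use pos in \<open>auto intro!: AE_I2 simp: less_le\<close>)
    then show False by (simp add: AE_iff_measurable[OF _ refl] emeasure_lborel_UNIV)
  qed
  moreover have "moment 0 0 l t \<ge> 0"
    unfolding moment_def using pos by (intro integral_nonneg_AE AE_I2 less_imp_le)
  ultimately show ?thesis by simp
qed

lemma F_strict_mono:
  assumes "t \<ge> 0" "l < l'" shows "F l t < F l' t"
  using moment_pos[OF assms(1)] s F_deriv_level[OF assms(1)]
  by (intro DERIV_pos_imp_increasing[OF assms(2)]) (auto intro!: exI mult_pos_pos)

lemma F_le_iff: "t \<ge> 0 \<Longrightarrow> F l t \<le> F l' t \<longleftrightarrow> l \<le> l'"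
  using F_strict_mono[of t l l'] F_strict_mono[of t l' l] by (cases l l' rule: linorder_cases) auto

lemma F_less_iff: "t \<ge> 0 \<Longrightarrow> F l t < F l' t \<longleftrightarrow> l < l'"
  using F_le_iff[of t l' l] by (simp add: not_le[symmetric])

lemma F_seq_limit:
  assumes "\<And>d. (\<lambda>n. std_normal_cdf (arg (X n) t d)) \<longlonglongrightarrow> c"
  shows "(\<lambda>n. F (X n) t) \<longlonglongrightarrow> c"
proof -
  have "(\<lambda>n. F (X n) t) \<longlonglongrightarrow> (\<integral>d. \<psi> d * c \<partial>lborel)"
    unfolding F_def
    by (rule integral_dominated_convergence[where w=\<psi>])
       (auto intro!: tendsto_intros assms AE_I2 mult_right_le_one_le simp: abs_mult std_normal_cdf_bounds \<tau>)
  then show ?thesis using \<tau> by simp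
qed

lemma F_surj:
  assumes t: "t \<ge> 0" and \<alpha>: "0 < \<alpha>" "\<alpha> < 1"
  shows "\<exists>l. F l t = \<alpha>"
proof -
  have arg_eq: "arg l t d = s * l + s * (- ln (1 + t * exp d) - m - k * d)" for l d
    by (simp add: arg_def algebra_simps)
  have sreal: "filterlim (\<lambda>n. s * real n) at_top sequentially"
    by (rule filterlim_tendsto_pos_mult_at_top[OF tendsto_const s filterlim_real_sequentially])
  have "(\<lambda>n. F (real n) t) \<longlonglongrightarrow> 1"
  proof (rule F_seq_limit, rule filterlim_compose[OF std_normal_cdf_at_top])
    show "filterlim (\<lambda>n. arg (real n) t d) at_top sequentially" for d
      unfolding arg_eq by (subst add.commute) (rule filterlim_tendsto_add_at_top[OF tendsto_const sreal])
  qed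
  from order_tendstoD(1)[OF this \<alpha>(2)] obtain n where n: "\<alpha> < F (real n) t"
    by (auto simp: eventually_sequentially)
  have "(\<lambda>n. F (- real n) t) \<longlonglongrightarrow> 0"
  proof (rule F_seq_limit, rule filterlim_compose[OF std_normal_cdf_at_bot])
    have "filterlim (\<lambda>n. - arg (- real n) t d) at_top sequentially" for d
      unfolding arg_eq minus_add_distrib mult_minus_right minus_minus
      by (subst add.commute) (rule filterlim_tendsto_add_at_top[OF tendsto_const sreal])
    then show "filterlim (\<lambda>n. arg (- real n) t d) at_bot sequentially" for d
      by (simp add: filterlim_uminus_at_top)
  qed
  from order_tendstoD(2)[OF this \<alpha>(1)] obtain n' where n': "F (- real n') t < \<alpha>"
    by (auto simp: eventually_sequentially)
  have "- real n' \<le> real n" by simp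
  then show ?thesis
    using IVT[of "\<lambda>l. F l t" "- real n'" \<alpha> "real n"] n n' F_deriv_level[OF t]
    by (meson DERIV_isCont less_imp_le)
qed

text \<open>The logarithm of the \<open>\<alpha>\<close>-quantile of \<open>X$i + t * X$j\<close>.
  The description has a unique witness for \<open>t \<ge> 0\<close> and \<open>\<alpha>\<close>
  strictly between 0 and 1.\<close>

definition level :: "real \<Rightarrow> real \<Rightarrow> real" where
  "level \<alpha> t = (THE l. F l t = \<alpha>)"

lemma level_unique: "t \<ge> 0 \<Longrightarrow> F l t = \<alpha> \<Longrightarrow> level \<alpha> t = l"
  unfolding level_def
  by (rule the_equality, assumption) (metis F_strict_mono linorder_neq_iff)

lemma F_level: "t \<ge> 0 \<Longrightarrow> 0 < \<alpha> \<Longrightarrow> \<alpha> < 1 \<Longrightarrow> F (level \<alpha> t) t = \<alpha>"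
  using F_surj level_unique by metis

lemma curvature_expand:
  "\<psi> d * (\<phi> (arg l t d) * (s * arg l t d - 1) * (slope t d - r)\<^sup>2) =
    s * (\<psi> d * (\<phi> (arg l t d) * arg l t d ^ 1 * slope t d ^ 2))
    - \<psi> d * (\<phi> (arg l t d) * arg l t d ^ 0 * slope t d ^ 2)
    - 2 * r * (s * (\<psi> d * (\<phi> (arg l t d) * arg l t d ^ 1 * slope t d ^ 1))
      - \<psi> d * (\<phi> (arg l t d) * arg l t d ^ 0 * slope t d ^ 1))
    + r\<^sup>2 * (s * (\<psi> d * (\<phi> (arg l t d) * arg l t d ^ 1 * slope t d ^ 0))
      - \<psi> d * (\<phi> (arg l t d) * arg l t d ^ 0 * slope t d ^ 0))"
  by (simp add: power2_eq_square algebra_simps)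

lemma integrable_curvature:
  assumes "t \<ge> 0"
  shows "integrable lborel (\<lambda>d. \<psi> d * (\<phi> (arg l t d) * (s * arg l t d - 1) * (slope t d - r)\<^sup>2))"
  unfolding curvature_expand
  by (intro Bochner_Integration.integrable_diff Bochner_Integration.integrable_add integrable_mult_right
      integrable_moment assms) simp_all

end

section \<open>Differentiating the level curve at a fixed probability\<close>

locale gauss_mix_level = gauss_mix +
  fixes \<alpha> :: real
  assumes \<alpha>: "0 < \<alpha>" "\<alpha> < 1"
begin

abbreviation L :: "real \<Rightarrow> real" where "L \<equiv> level \<alpha>"

definition rate :: "real \<Rightarrow> real" where
  "rate t = moment 0 1 (L t) t / moment 0 0 (L t) t"

lemma F_L: "t \<ge> 0 \<Longrightarrow> F (L t) t = \<alpha>"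
  using F_level \<alpha> by simp

text \<open>Monotonicity in the level turns a bound on \<open>L t'\<close> by a constant
  \<open>a\<close> into a strict inequality between \<open>F a t'\<close> and
  \<open>\<alpha>\<close>, which persists near \<open>t\<close> because \<open>F a\<close> is
  continuous in the weight.\<close>

lemma L_continuous:
  assumes t: "t \<ge> 0"
  shows "(L \<longlongrightarrow> L t) (at t within {0..})"
proof (rule order_tendstoI)
  have lim: "((\<lambda>t'. F l t') \<longlongrightarrow> F l t) (at t within {0..})" for l
    using DERIV_continuous[OF F_deriv_weight[OF t]] by (simp add: continuous_within)
  have nn: "\<forall>\<^sub>F t' in at t within {0..}. t' \<ge> 0"
    by (auto simp: eventually_at_filter)
  fix a
  { assume "a < L t"
    then have "F a t < \<alpha>" using F_strict_mono[OF t] F_L[OF t] by metis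
    from order_tendstoD(2)[OF lim this] nn show "\<forall>\<^sub>F x in at t within {0..}. a < L x"
      by eventually_elim (metis F_L F_less_iff) }
  { assume "L t < a"
    then have "\<alpha> < F a t" using F_strict_mono[OF t] F_L[OF t] by metis
    from order_tendstoD(1)[OF lim this] nn show "\<forall>\<^sub>F x in at t within {0..}. L x < a"
      by eventually_elim (metis F_L F_less_iff) }
qed

text \<open>A one-sided implicit function theorem. Since \<open>F (L t') t' = F (L t) t\<close>, the
  mean value theorem in the level expresses the difference quotient of \<open>L\<close> by that of
  \<open>F (L t)\<close> in the weight, divided by \<open>s * moment 0 0\<close> at an intermediate
  level, which converges by joint continuity.\<close>

lemma L_deriv:
  assumes t: "t \<ge> 0"
  shows "(L has_real_derivative rate t) (at t within {0..})"
proof -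
  have "\<exists>\<xi>. \<bar>\<xi> - L t\<bar> \<le> \<bar>L t' - L t\<bar> \<and> F (L t') t' - F (L t) t' = (L t' - L t) * (s * moment 0 0 \<xi> t')"
    if "t' \<ge> 0" for t'
    using mvt_real_two_sided[of "\<lambda>l. F l t'", OF F_deriv_level[OF that]] .
  then obtain \<xi> where \<xi>: "\<And>t'. t' \<ge> 0 \<Longrightarrow> \<bar>\<xi> t' - L t\<bar> \<le> \<bar>L t' - L t\<bar>"
    "\<And>t'. t' \<ge> 0 \<Longrightarrow> F (L t') t' - F (L t) t' = (L t' - L t) * (s * moment 0 0 (\<xi> t') t')"
    by metis
  have nn: "\<forall>\<^sub>F t' in at t within {0..}. t' \<ge> 0"
    by (auto simp: eventually_at_filter)
  have "((\<lambda>t'. \<xi> t' - L t) \<longlongrightarrow> 0) (at t within {0..})"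
  proof (rule tendsto_rabs_zero_cancel, rule tendsto_sandwich[OF _ _ tendsto_const])
    show "((\<lambda>t'. \<bar>L t' - L t\<bar>) \<longlongrightarrow> 0) (at t within {0..})"
      using L_continuous[OF t] by (simp add: tendsto_rabs_zero_iff LIM_zero_iff)
    show "\<forall>\<^sub>F x in at t within {0..}. \<bar>\<xi> x - L t\<bar> \<le> \<bar>L x - L t\<bar>"
      using nn by eventually_elim (rule \<xi>)
  qed simp
  then have \<xi>_lim: "(\<xi> \<longlongrightarrow> L t) (at t within {0..})" by (simp add: LIM_zero_iff)
  have "((\<lambda>t'. moment 0 0 (\<xi> t') t') \<longlongrightarrow> moment 0 0 (L t) t) (at t within {0..})"
  proof -
    have "continuous (at (L t, t) within UNIV \<times> {0..}) (\<lambda>p. moment 0 0 (fst p) (snd p))"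
      using moment_derivative[OF t] by (rule has_derivative_continuous)
    moreover have "((\<lambda>t'. (\<xi> t', t')) \<longlongrightarrow> (L t, t)) (at t within {0..})"
      by (intro tendsto_Pair \<xi>_lim tendsto_ident_at)
    moreover have "\<forall>\<^sub>F t' in at t within {0..}. (\<xi> t', t') \<in> UNIV \<times> {0..}"
      using nn by eventually_elim simp
    ultimately have "((\<lambda>t'. moment 0 0 (fst (\<xi> t', t')) (snd (\<xi> t', t'))) \<longlongrightarrow> moment 0 0 (fst (L t, t)) (snd (L t, t))) (at t within {0..})"
      by (intro continuous_within_tendsto_compose[where f="\<lambda>p. moment 0 0 (fst p) (snd p)"])
    then show ?thesis by simp
  qed
  moreover have "((\<lambda>t'. (F (L t) t' - F (L t) t) / (t' - t)) \<longlongrightarrow> - s * moment 0 1 (L t) t) (at t within {0..})"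
    using F_deriv_weight[OF t, of "L t"] by (simp add: has_field_derivative_iff)
  ultimately have "((\<lambda>t'. - ((F (L t) t' - F (L t) t) / (t' - t)) / (s * moment 0 0 (\<xi> t') t')) \<longlongrightarrow>
     - (- s * moment 0 1 (L t) t) / (s * moment 0 0 (L t) t)) (at t within {0..})"
    using moment_pos[OF t, of "L t"] s by (intro tendsto_intros) auto
  moreover have "- (- s * moment 0 1 (L t) t) / (s * moment 0 0 (L t) t) = rate t"
    using s by (simp add: rate_def)
  moreover have "\<forall>\<^sub>F t' in at t within {0..}. - ((F (L t) t' - F (L t) t) / (t' - t)) / (s * moment 0 0 (\<xi> t') t')
      = (L t' - L t) / (t' - t)"
    using nn
  proof eventually_elim
    case (elim t')
    define c where "c = s * moment 0 0 (\<xi> t') t'"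
    have "F (L t) t' - F (L t) t = - ((L t' - L t) * c)"
      using \<xi>(2)[OF elim] F_L[OF elim] F_L[OF t] by (simp add: c_def)
    moreover have "c \<noteq> 0" using moment_pos[OF elim, of "\<xi> t'"] s by (simp add: c_def)
    ultimately show ?case unfolding c_def[symmetric] by simp
  qed
  ultimately have "((\<lambda>t'. (L t' - L t) / (t' - t)) \<longlongrightarrow> rate t) (at t within {0..})"
    using Lim_transform_eventually by force
  then show ?thesis by (simp add: has_field_derivative_iff)
qed

lemma moment_L_deriv:
  assumes t: "t \<ge> 0"
  shows "((\<lambda>t. moment 0 j (L t) t) has_real_derivative
    (s * moment 1 (Suc j) (L t) t - real j * moment 0 (Suc j) (L t) t) - s * moment 1 j (L t) t * rate t) (at t within {0..})"
proof -
  have "((\<lambda>t. (L t, t)) has_derivative (\<lambda>h. (rate t * h, h))) (at t within {0..})"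
    using L_deriv[OF t] by (intro has_derivative_Pair) (auto simp: has_field_derivative_def)
  then have "((\<lambda>p. moment 0 j (fst p) (snd p)) \<circ> (\<lambda>t. (L t, t)) has_derivative
    (\<lambda>h. (s * moment 1 (Suc j) (L t) t - real j * moment 0 (Suc j) (L t) t) * snd h - s * moment 1 j (L t) t * fst h) \<circ> (\<lambda>h. (rate t * h, h))) (at t within {0..})"
    by (intro diff_chain_within has_derivative_subset[OF moment_derivative[OF t]]) auto
  then show ?thesis
    unfolding has_field_derivative_def comp_def fst_conv snd_conv
    by (elim has_derivative_eq_rhs) (auto simp: fun_eq_iff algebra_simps)
qed

text \<open>Up to a positive factor, \<open>second\<close> is the second derivative of the quantile \<open>exp (L t)\<close>.\<close>

definition second :: "real \<Rightarrow> real" where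
  "second t = (\<integral>d. \<psi> d * (\<phi> (arg (L t) t d) * (s * arg (L t) t d - 1) * (slope t d - rate t)\<^sup>2) \<partial>lborel)"

lemma exp_L_deriv:
  assumes t: "t \<ge> 0"
  shows "((\<lambda>t. exp (L t)) has_real_derivative exp (L t) * rate t) (at t within {0..})"
  using L_deriv[OF t] by (auto intro!: derivative_eq_intros)

text \<open>As \<open>rate t\<close> is the mean of \<open>slope t\<close> under the weight
  \<open>\<psi> * \<phi>\<close>, the terms without \<open>arg\<close>, namely
  \<open>(rate t)\<^sup>2 * moment 0 0 - moment 0 2\<close>, are minus the integral of the weighted
  \<open>(slope t d - rate t)\<^sup>2\<close>. This completes the square in
  \<open>second\<close>.\<close>

lemma exp_L_deriv2:
  assumes t: "t \<ge> 0"
  shows "((\<lambda>t. exp (L t) * rate t) has_real_derivative exp (L t) / moment 0 0 (L t) t * second t) (at t within {0..})"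
proof -
  let ?M = "\<lambda>i j. moment i j (L t) t"
  have i: "integrable lborel (\<lambda>d. \<psi> d * (\<phi> (arg (L t) t d) * arg (L t) t d ^ i * slope t d ^ n))" if "i \<le> 1" for i n
    using integrable_moment[OF t that] .
  have second: "second t = s * ?M 1 2 - ?M 0 2 - 2 * rate t * (s * ?M 1 1 - ?M 0 1) + (rate t)\<^sup>2 * (s * ?M 1 0 - ?M 0 0)"
    unfolding second_def curvature_expand moment_def
    using i[of 0 0] i[of 0 1] i[of 0 2] i[of 1 0] i[of 1 1] i[of 1 2] by (simp del: power_0 power_one_right)
  have M: "?M 0 0 > 0" using moment_pos[OF t] .
  have M1: "?M 0 1 = rate t * ?M 0 0" using M by (simp add: rate_def)
  have d1: "((\<lambda>t. moment 0 1 (L t) t) has_real_derivative s * ?M 1 2 - ?M 0 2 - s * ?M 1 1 * rate t) (at t within {0..})"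
    using moment_L_deriv[OF t, of 1] by (simp add: numeral_2_eq_2)
  have d0: "((\<lambda>t. moment 0 0 (L t) t) has_real_derivative s * ?M 1 1 - s * ?M 1 0 * rate t) (at t within {0..})"
    using moment_L_deriv[OF t, of 0] by simp
  have algebra: "e * r * (r * a / a) + (((s * b2 - a2 - s * b1 * r) * a - r * a * (s * b1 - s * b0 * r)) / (a * a)) * e
      = e / a * (s * b2 - a2 - 2 * r * (s * b1 - r * a) + r\<^sup>2 * (s * b0 - a))" if "a > 0" for e r a a2 b0 b1 b2 :: real
    using that by (simp add: divide_simps power2_eq_square) (simp add: algebra_simps)
  have "((\<lambda>t. exp (L t) * (moment 0 1 (L t) t / moment 0 0 (L t) t)) has_real_derivative
    exp (L t) / ?M 0 0 * second t) (at t within {0..})"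
    using DERIV_mult[OF exp_L_deriv[OF t] DERIV_divide[OF d1 d0]] M
    unfolding M1 second algebra[OF M] by simp
  then show ?thesis by (simp add: rate_def[abs_def])
qed

end

section \<open>Positive curvature at high levels\<close>

text \<open>As a function of \<open>x\<close>, \<open>ln (1 + t * exp x)\<close> has slope between 0
  and 1.\<close>

lemma ln_one_plus_exp_lipschitz:
  fixes t :: real
  assumes "t \<ge> 0"
  shows "\<bar>ln (1 + t * exp x) - ln (1 + t * exp y)\<bar> \<le> \<bar>x - y\<bar>"
proof (induction x y rule: linorder_wlog)
  case (le x y)
  have pos: "1 + t * exp z > 0" for z using assms by (simp add: add_pos_nonneg)
  have "exp (y - x) * (1 + t * exp x) = exp (y - x) + t * exp y"
    by (simp add: algebra_simps exp_diff)
  then have "1 + t * exp y \<le> exp (y - x) * (1 + t * exp x)" using le by simp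
  then have "ln (1 + t * exp y) \<le> ln (exp (y - x) * (1 + t * exp x))" using pos by simp
  also have "\<dots> = (y - x) + ln (1 + t * exp x)" using pos[of x] by (simp add: ln_mult)
  finally have "ln (1 + t * exp y) \<le> (y - x) + ln (1 + t * exp x)" .
  moreover have "ln (1 + t * exp x) \<le> ln (1 + t * exp y)"
    using le assms pos by (simp add: mult_left_mono)
  ultimately show ?case using le by simp
qed (simp add: abs_minus_commute)

context gauss_mix begin

text \<open>The constant does not involve \<open>l\<close>, so the radius \<open>N\<close> in the
  curvature estimate can be fixed before the level is raised.\<close>

lemma arg_lipschitz:
  assumes "t \<ge> 0"
  shows "\<bar>arg l t x - arg l t y\<bar> \<le> s * (1 + \<bar>k\<bar>) * \<bar>x - y\<bar>"
proof -
  have "arg l t x - arg l t y = s * ((ln (1 + t * exp y) - ln (1 + t * exp x)) + k * (y - x))"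
    unfolding arg_def by (simp add: algebra_simps)
  then have "\<bar>arg l t x - arg l t y\<bar> = s * \<bar>(ln (1 + t * exp y) - ln (1 + t * exp x)) + k * (y - x)\<bar>"
    using s by (simp add: abs_mult)
  also have "\<dots> \<le> s * (\<bar>y - x\<bar> + \<bar>k\<bar> * \<bar>y - x\<bar>)"
    using s ln_one_plus_exp_lipschitz[OF assms, of y x]
    by (intro mult_left_mono order_trans[OF abs_triangle_ineq] add_mono) (auto simp: abs_mult)
  also have "\<dots> = s * (1 + \<bar>k\<bar>) * \<bar>x - y\<bar>"
    by (simp add: algebra_simps abs_minus_commute)
  finally show ?thesis .
qed

text \<open>\<open>slope t d - r\<close> is affine in \<open>exp d\<close> up to the factor \<open>1 / (1 + t * exp d)\<close>, and affine in
  \<open>exp (- d)\<close> up to the factor \<open>1 / (exp (- d) + t)\<close>; both factors decrease away from the origin.\<close>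

lemma curvature_nonneg:
  assumes t: "t \<ge> 0"
  shows "\<exists>l0. \<forall>l\<ge>l0. \<forall>r. 0 \<le> (\<integral>d. \<psi> d * (\<phi> (arg l t d) * (s * arg l t d - 1) * (slope t d - r)\<^sup>2) \<partial>lborel)"
proof -
  define \<kappa> where "\<kappa> = s * (1 + \<bar>k\<bar>)"
  have \<kappa>: "\<kappa> \<ge> 0" using s by (simp add: \<kappa>_def)
  obtain N1 where N1: "N1 \<ge> 0" and half1: "\<And>\<theta> \<omega> p r. \<lbrakk>\<And>x y. 0 \<le> x \<Longrightarrow> 0 \<le> y \<Longrightarrow> \<bar>\<theta> x - \<theta> y\<bar> \<le> \<kappa> * \<bar>x - y\<bar>;
       \<And>x. 0 \<le> x \<Longrightarrow> x \<le> N1 \<Longrightarrow> s * \<theta> x > 2;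
       \<And>x y. 0 \<le> x \<Longrightarrow> x \<le> y \<Longrightarrow> \<omega> y \<le> \<omega> x; \<And>x. 0 \<le> \<omega> x;
       integrable lborel (\<lambda>x. indicator {0..} x * (normal_density \<delta> \<tau> x * (std_normal_density (\<theta> x) * (s * \<theta> x - 1) * ((p * exp x - r)\<^sup>2 * \<omega> x))))\<rbrakk>
     \<Longrightarrow> 0 \<le> (\<integral>x. indicator {0..} x * (normal_density \<delta> \<tau> x * (std_normal_density (\<theta> x) * (s * \<theta> x - 1) * ((p * exp x - r)\<^sup>2 * \<omega> x))) \<partial>lborel)"
    using right_half_nonneg[OF \<tau> s \<kappa>, of \<delta>] by blast
  \<comment> \<open>The negative half-line is reflected to the positive one, which changes the mean
    to \<open>- \<delta>\<close>.\<close>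
  obtain N2 where N2: "N2 \<ge> 0" and half2: "\<And>\<theta> \<omega> p r. \<lbrakk>\<And>x y. 0 \<le> x \<Longrightarrow> 0 \<le> y \<Longrightarrow> \<bar>\<theta> x - \<theta> y\<bar> \<le> \<kappa> * \<bar>x - y\<bar>;
       \<And>x. 0 \<le> x \<Longrightarrow> x \<le> N2 \<Longrightarrow> s * \<theta> x > 2;
       \<And>x y. 0 \<le> x \<Longrightarrow> x \<le> y \<Longrightarrow> \<omega> y \<le> \<omega> x; \<And>x. 0 \<le> \<omega> x;
       integrable lborel (\<lambda>x. indicator {0..} x * (normal_density (- \<delta>) \<tau> x * (std_normal_density (\<theta> x) * (s * \<theta> x - 1) * ((p * exp x - r)\<^sup>2 * \<omega> x))))\<rbrakk>
     \<Longrightarrow> 0 \<le> (\<integral>x. indicator {0..} x * (normal_density (- \<delta>) \<tau> x * (std_normal_density (\<theta> x) * (s * \<theta> x - 1) * ((p * exp x - r)\<^sup>2 * \<omega> x))) \<partial>lborel)"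
    using right_half_nonneg[OF \<tau> s \<kappa>, of "- \<delta>"] by blast
  define N where "N = max N1 N2"
  \<comment> \<open>Chosen so that \<open>arg l t 0 \<ge> 2 / s + \<kappa> * N + 1\<close>: over
    distance \<open>N\<close> at most \<open>\<kappa> * N\<close> is lost, and the 1 makes the
    inequality strict.\<close>
  define l0 where "l0 = ln (1 + t) + m + (2 / s + \<kappa> * N + 1) / s"
  have start: "s * arg l t d > 2" if "l \<ge> l0" "\<bar>d\<bar> \<le> N" for l d
  proof -
    have "\<bar>arg l t d - arg l t 0\<bar> \<le> \<kappa> * \<bar>d\<bar>"
      using arg_lipschitz[OF t, of l d 0] by (simp add: \<kappa>_def)
    also have "\<dots> \<le> \<kappa> * N" using that \<kappa> by (intro mult_left_mono)
    finally have "arg l t d \<ge> arg l t 0 - \<kappa> * N" by linarith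
    moreover have "2 / s + \<kappa> * N + 1 \<le> arg l t 0"
      using that(1) s by (simp add: l0_def arg_def field_simps)
    ultimately have "arg l t d > 2 / s" by linarith
    then show ?thesis using s by (simp add: field_simps)
  qed
  show ?thesis
  proof (intro exI[of _ l0] allI impI)
    fix l r assume l: "l \<ge> l0"
    define g where "g d = \<psi> d * (\<phi> (arg l t d) * (s * arg l t d - 1) * (slope t d - r)\<^sup>2)" for d
    have int: "integrable lborel g"
      unfolding g_def by (rule integrable_curvature[OF t])
    have int_neg: "integrable lborel (\<lambda>d. g (- d))"
      using lborel_integrable_real_affine[OF int, of "-1" 0] by simp
    have intI: "integrable lborel (\<lambda>x. indicator {0..} x * f x)" if "integrable lborel f" for f :: "real \<Rightarrow> real"
      using integrable_mult_indicator[OF _ that, of "{0..}"] by simp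
    have pos: "1 + t * exp d > 0" "exp d + t > 0" for d using t by (simp_all add: add_pos_nonneg)
    have eq1: "g d = normal_density \<delta> \<tau> d * (\<phi> (arg l t d) * (s * arg l t d - 1) * (((1 - r * t) * exp d - r)\<^sup>2 * (1 / (1 + t * exp d))\<^sup>2))" for d
    proof -
      have "slope t d - r = ((1 - r * t) * exp d - r) * (1 / (1 + t * exp d))"
        using pos[of d] by (simp add: slope_def field_simps)
      then show ?thesis unfolding g_def by (simp only: power_mult_distrib)
    qed
    \<comment> \<open>Reflection swaps the two affine coefficients \<open>1 - r * t\<close> and
      \<open>r\<close>; the overall sign disappears in the square.\<close>
    have eq2: "g (- d) = normal_density (- \<delta>) \<tau> d * (\<phi> (arg l t (- d)) * (s * arg l t (- d) - 1) * ((r * exp d - (1 - r * t))\<^sup>2 * (1 / (exp d + t))\<^sup>2))" for d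
    proof -
      have "slope t (- d) = 1 / (exp d + t)"
        using pos(2)[of d] by (simp add: slope_def exp_minus field_simps)
      then have "slope t (- d) - r = - ((r * exp d - (1 - r * t)) * (1 / (exp d + t)))"
        using pos[of d] by (simp add: field_simps)
      moreover have "normal_density \<delta> \<tau> (- d) = normal_density (- \<delta>) \<tau> d"
        by (simp add: normal_density_def power2_eq_square algebra_simps)
      ultimately show ?thesis unfolding g_def by (simp only: power_mult_distrib power2_minus)
    qed
    have "0 \<le> (\<integral>d. indicator {0..} d * g d \<partial>lborel)"
      unfolding eq1
    proof (rule half1)
      show "2 < s * arg l t x" if "0 \<le> x" "x \<le> N1" for x
        using that by (intro start l) (simp add: N_def)
      show "(1 / (1 + t * exp y))\<^sup>2 \<le> (1 / (1 + t * exp x))\<^sup>2" if "x \<le> y" for x y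
        using that t pos by (intro power_mono divide_left_mono add_left_mono mult_left_mono mult_pos_pos) (auto intro: less_imp_le)
      show "integrable lborel (\<lambda>d. indicator {0..} d * (normal_density \<delta> \<tau> d * (\<phi> (arg l t d) * (s * arg l t d - 1) * (((1 - r * t) * exp d - r)\<^sup>2 * (1 / (1 + t * exp d))\<^sup>2))))"
        unfolding eq1[symmetric] by (rule intI[OF int])
    qed (use arg_lipschitz[OF t] in \<open>auto simp: \<kappa>_def\<close>)
    moreover have "0 \<le> (\<integral>d. indicator {0..} d * g (- d) \<partial>lborel)"
      unfolding eq2
    proof (rule half2)
      show "2 < s * arg l t (- x)" if "0 \<le> x" "x \<le> N2" for x
        using that by (intro start l) (simp add: N_def)
      show "(1 / (exp y + t))\<^sup>2 \<le> (1 / (exp x + t))\<^sup>2" if "x \<le> y" for x y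
        using that t pos by (intro power_mono divide_left_mono add_right_mono mult_pos_pos) (auto intro: less_imp_le)
      show "integrable lborel (\<lambda>d. indicator {0..} d * (normal_density (- \<delta>) \<tau> d * (\<phi> (arg l t (- d)) * (s * arg l t (- d) - 1) * ((r * exp d - (1 - r * t))\<^sup>2 * (1 / (exp d + t))\<^sup>2))))"
        unfolding eq2[symmetric] by (rule intI[OF int_neg])
      show "\<bar>arg l t (- x) - arg l t (- y)\<bar> \<le> \<kappa> * \<bar>x - y\<bar>" for x y
        using arg_lipschitz[OF t, of l "- x" "- y"] by (simp add: \<kappa>_def abs_minus_commute)
    qed auto
    moreover have "(\<integral>d. indicator {0..} d * g (- d) \<partial>lborel) = (\<integral>d. indicator {..0} d * g d \<partial>lborel)"
      by (subst lborel_integral_real_affine[of "-1" _ 0])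
         (auto intro!: Bochner_Integration.integral_cong simp: indicator_def)
    moreover have "(\<integral>d. indicator {0..} d * g d \<partial>lborel) + (\<integral>d. indicator {..0} d * g d \<partial>lborel) = (\<integral>d. g d \<partial>lborel)"
    proof -
      have i: "integrable lborel (\<lambda>x. indicator {..0} x * g x)"
        using integrable_mult_indicator[OF _ int, of "{..0}"] by simp
      have "(\<integral>d. indicator {0..} d * g d \<partial>lborel) + (\<integral>d. indicator {..0} d * g d \<partial>lborel)
          = (\<integral>d. indicator {0..} d * g d + indicator {..0} d * g d \<partial>lborel)"
        using intI[OF int] i by simp
      also have "\<dots> = (\<integral>d. g d \<partial>lborel)"
        using int intI[OF int] i
        by (intro integral_cong_AE AE_mp[OF AE_lborel_singleton[of 0] AE_I2])
           (auto simp: indicator_def borel_measurable_integrable)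
      finally show ?thesis .
    qed
    ultimately show "0 \<le> (\<integral>d. \<psi> d * (\<phi> (arg l t d) * (s * arg l t d - 1) * (slope t d - r)\<^sup>2) \<partial>lborel)"
      by (simp add: g_def[symmetric])
  qed
qed

end

section \<open>From curvature to convexity of the quantile\<close>

text \<open>The Hessian of the perspective \<open>w$i * Q (w$j / w$i)\<close> of \<open>Q\<close> is \<open>Q''\<close> times a rank one matrix.\<close>

lemma convex_at_perspective:
  fixes f :: "real ^ 2 \<Rightarrow> real" and i j :: 2
  assumes u: "u \<in> quadrant" "u $ i > 0"
    and f: "\<And>w. w \<in> quadrant \<Longrightarrow> w $ i > 0 \<Longrightarrow> f w = w $ i * Q (w $ j / w $ i)"
    and Q: "\<And>t. t \<ge> 0 \<Longrightarrow> (Q has_real_derivative Q1 t) (at t within {0..})"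
    and Q1: "(Q1 has_real_derivative q2) (at (u $ j / u $ i) within {0..})"
    and q2: "q2 \<ge> 0"
  shows "convex_at f u"
proof -
  define S where "S = quadrant \<inter> {w :: real ^ 2. w $ i > 0}"
  define T where "T w = w $ j / w $ i" for w :: "real ^ 2"
  have op: "open {w :: real ^ 2. w $ i > 0}"
    by (intro open_Collect_less continuous_intros)
  \<comment> \<open>The ratio \<open>T\<close> is only meaningful for \<open>w $ i > 0\<close>, an
    open condition, so passing to \<open>S\<close> leaves the derivatives unchanged.\<close>
  have S: "at w within quadrant = at w within S" if "w $ i > 0" for w
    using that op by (intro at_within_nhd[of _ "{w. w $ i > 0}"]) (auto simp: S_def)
  have nonneg: "w $ a \<ge> 0" if "w \<in> quadrant" for w :: "real ^ 2" and a
    using that exhaust_2[of a] by (auto simp: quadrant_def)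
  have nth: "((\<lambda>w :: real ^ 2. w $ a) has_derivative (\<lambda>h. h $ a)) F" for a F
    by (intro bounded_linear_imp_has_derivative bounded_linear_vec_nth)
  have T: "(T has_derivative (\<lambda>h. (h $ j - T w * h $ i) / w $ i)) (at w within S)" if "w $ i > 0" for w
    unfolding T_def using that
    by (auto intro!: derivative_eq_intros nth simp: field_simps power2_eq_square)
  have comp: "((\<lambda>w. q (T w)) has_derivative (\<lambda>h. q' * ((h $ j - T w * h $ i) / w $ i))) (at w within S)"
    if "w \<in> S" "(q has_real_derivative q') (at (T w) within {0..})" for w q q'
  proof -
    have "T ` S \<subseteq> {0..}" by (auto simp: S_def T_def nonneg)
    then have "(q has_derivative (*) q') (at (T w) within T ` S)"
      using that(2) unfolding has_field_derivative_def by (rule has_derivative_subset[rotated])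
    moreover have "w $ i > 0" using that(1) by (simp add: S_def)
    ultimately show ?thesis
      using diff_chain_within[OF T, of w q "(*) q'"] by (simp add: comp_def)
  qed
  define g :: "real ^ 2 \<Rightarrow> real ^ 2" where
    "g w = (Q (T w) - T w * Q1 (T w)) *\<^sub>R axis i 1 + Q1 (T w) *\<^sub>R axis j 1" for w
  \<comment> \<open>\<open>u $ i *\<^sub>R n\<close> has the components of \<open>u\<close> rotated
    by a right angle, up to sign, when \<open>i\<close> and \<open>j\<close> differ. Hence
    \<open>H\<close> annihilates \<open>u\<close>, as homogeneity of degree one demands.\<close>
  define n :: "real ^ 2" where "n = axis j 1 - T u *\<^sub>R axis i 1"
  define H :: "real ^ 2 ^ 2" where "H = (\<chi> a b. q2 / u $ i * n $ a * n $ b)"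
  have Hv: "H *v h = (q2 / u $ i * (n \<bullet> h)) *\<^sub>R n" for h
    by (simp add: vec_eq_iff H_def matrix_vector_mult_def inner_vec_def sum_distrib_left mult_ac)
  have uS: "u \<in> S" using u by (simp add: S_def)
  have "\<forall>\<^sub>F w in nhds u. w $ i > 0"
    using op u by (auto simp: eventually_nhds)
  then have "\<forall>\<^sub>F w in nhds u. w \<in> quadrant \<longrightarrow> (f has_derivative (\<lambda>h. g w \<bullet> h)) (at w within quadrant)"
  proof eventually_elim
    case (elim w)
    show ?case
    proof
      assume "w \<in> quadrant"
      then have w: "w \<in> S" using elim by (simp add: S_def)
      have "T w \<ge> 0" using \<open>w \<in> quadrant\<close> elim by (simp add: T_def nonneg)
      from comp[OF w Q[OF this]]
      have "((\<lambda>w. w $ i * Q (T w)) has_derivative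
        (\<lambda>h. w $ i * (Q1 (T w) * ((h $ j - T w * h $ i) / w $ i)) + h $ i * Q (T w))) (at w within S)"
        by (intro has_derivative_mult nth)
      moreover have gw: "g w \<bullet> h = (Q (T w) - T w * Q1 (T w)) * h $ i + Q1 (T w) * h $ j" for h
        by (simp only: g_def inner_add_left inner_scaleR_left inner_axis' inner_real_def mult_1)
      ultimately have "((\<lambda>w. w $ i * Q (T w)) has_derivative (\<lambda>h. g w \<bullet> h)) (at w within S)"
        by (elim has_derivative_eq_rhs) (simp only: fun_eq_iff gw, use elim in \<open>simp add: field_simps\<close>)
      then have "(f has_derivative (\<lambda>h. g w \<bullet> h)) (at w within S)"
        using w by (elim has_derivative_transform[rotated 2]) (auto simp: S_def T_def f)
      then show "(f has_derivative (\<lambda>h. g w \<bullet> h)) (at w within quadrant)"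
        using S[OF elim] by simp
    qed
  qed
  moreover have "(g has_derivative (\<lambda>h. H *v h)) (at u within quadrant)"
  proof -
    have "T u \<ge> 0" using u by (simp add: T_def nonneg)
    note dQ = comp[OF uS Q[OF this]] and dQ1 = comp[OF uS Q1[folded T_def]]
    have "(g has_derivative (\<lambda>h. (Q1 (T u) * ((h $ j - T u * h $ i) / u $ i)
         - (T u * (q2 * ((h $ j - T u * h $ i) / u $ i)) + (h $ j - T u * h $ i) / u $ i * Q1 (T u))) *\<^sub>R axis i 1
         + (q2 * ((h $ j - T u * h $ i) / u $ i)) *\<^sub>R axis j 1)) (at u within S)"
      unfolding g_def using u
      by (intro has_derivative_add has_derivative_scaleR_left has_derivative_diff has_derivative_mult dQ dQ1 T)
    moreover have "H *v h = (Q1 (T u) * ((h $ j - T u * h $ i) / u $ i)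
         - (T u * (q2 * ((h $ j - T u * h $ i) / u $ i)) + (h $ j - T u * h $ i) / u $ i * Q1 (T u))) *\<^sub>R axis i 1
         + (q2 * ((h $ j - T u * h $ i) / u $ i)) *\<^sub>R axis j 1" for h
    proof -
      have "n \<bullet> h = h $ j - T u * h $ i"
        by (simp add: n_def inner_diff_left inner_axis')
      moreover have "c * x - (b * (q2 * x) + x * c) = - (q2 * x * b)" for b c x :: real
        by (simp add: algebra_simps)
      ultimately show ?thesis
        unfolding Hv by (simp only:) (simp add: n_def scaleR_diff_right)
    qed
    ultimately show ?thesis using S[OF u(2)] by simp
  qed
  ultimately have "has_hessian_within f H u quadrant"
    unfolding has_hessian_within_def by blast
  moreover have "v \<bullet> (H *v v) \<ge> 0" for v
    using q2 u by (simp add: Hv inner_commute[of v] mult.assoc)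
  ultimately show ?thesis unfolding convex_at_def by blast
qed

context gauss_mix begin

lemma F_range:
  assumes "t \<ge> 0" shows "0 < F l t" "F l t < 1"
proof -
  have "0 \<le> F l t" for l
    unfolding F_def by (intro integral_nonneg_AE AE_I2) (simp add: std_normal_cdf_bounds)
  moreover have "F l t \<le> 1" for l
  proof -
    have "F l t \<le> (\<integral>d. \<psi> d \<partial>lborel)"
      unfolding F_def using integrable_cdf_arg \<tau>
      by (intro integral_mono) (auto intro!: mult_right_le_one_le simp: std_normal_cdf_bounds)
    then show ?thesis using \<tau> by simp
  qed
  ultimately show "0 < F l t" "F l t < 1"
    using F_strict_mono[OF assms, of "l - 1" l] F_strict_mono[OF assms, of l "l + 1"]
    by (smt (verit))+
qed

text \<open>Monotonicity of \<open>F\<close> turns a large level into a large probability, whence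
  the threshold \<open>F l0 (u $ j / u $ i)\<close>. The superlevel set of \<open>P w\<close> is a
  closed ray starting at \<open>w $ i * exp (L (w $ j / w $ i))\<close>; values
  \<open>y \<le> 0\<close> are excluded because \<open>\<alpha> > 0\<close>. The curvature sign is
  needed at \<open>u\<close> only.\<close>

lemma quantile_convex_at:
  fixes P :: "real ^ 2 \<Rightarrow> real \<Rightarrow> real" and i j :: 2
  assumes rep: "\<And>w y. w \<in> quadrant \<Longrightarrow> w $ i > 0 \<Longrightarrow> y > 0 \<Longrightarrow> P w y = F (ln (y / w $ i)) (w $ j / w $ i)"
    and nonpos: "\<And>w y. w \<in> quadrant \<Longrightarrow> w $ i > 0 \<Longrightarrow> y \<le> 0 \<Longrightarrow> P w y = 0"
    and u: "u \<in> quadrant" "u $ i > 0"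
  shows "\<exists>\<alpha>\<^sub>0. 0 < \<alpha>\<^sub>0 \<and> \<alpha>\<^sub>0 < 1 \<and> (\<forall>\<alpha>. \<alpha>\<^sub>0 \<le> \<alpha> \<and> \<alpha> < 1 \<longrightarrow> convex_at (\<lambda>w. Inf {y. \<alpha> \<le> P w y}) u)"
proof -
  have nonneg: "w $ j / w $ i \<ge> 0" if "w \<in> quadrant" for w
    using that exhaust_2[of i] exhaust_2[of j] by (auto simp: quadrant_def)
  let ?t = "u $ j / u $ i"
  have t: "?t \<ge> 0" using nonneg[OF u(1)] .
  obtain l0 where l0: "\<And>l r. l \<ge> l0 \<Longrightarrow> 0 \<le> (\<integral>d. \<psi> d * (\<phi> (arg l ?t d) * (s * arg l ?t d - 1) * (slope ?t d - r)\<^sup>2) \<partial>lborel)"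
    using curvature_nonneg[OF t] by blast
  show ?thesis
  proof (intro exI[of _ "F l0 ?t"] conjI allI impI F_range t)
    fix \<alpha> assume level: "F l0 ?t \<le> \<alpha> \<and> \<alpha> < 1"
    interpret gauss_mix_level \<delta> \<tau> s m k \<alpha>
      using level F_range[OF t, of l0] by unfold_locales auto
    have "F l0 ?t \<le> F (L ?t) ?t" using F_L[OF t] level by simp
    then have "l0 \<le> L ?t" using F_le_iff[OF t] by simp
    then have "second ?t \<ge> 0" unfolding second_def by (rule l0)
    then have nn: "exp (L ?t) / moment 0 0 (L ?t) ?t * second ?t \<ge> 0"
      using moment_pos[OF t, of "L ?t"] by simp
    have quant: "Inf {y. \<alpha> \<le> P w y} = w $ i * exp (L (w $ j / w $ i))" if w: "w \<in> quadrant" "w $ i > 0" for w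
    proof -
      let ?s = "w $ j / w $ i"
      note s0 = nonneg[OF w(1)]
      have "\<alpha> \<le> P w y \<longleftrightarrow> w $ i * exp (L ?s) \<le> y" for y
      proof (cases "y > 0")
        case True
        have "\<alpha> \<le> P w y \<longleftrightarrow> L ?s \<le> ln (y / w $ i)"
          using F_L[OF s0] F_le_iff[OF s0, of "L ?s" "ln (y / w $ i)"] rep[OF w True] by simp
        also have "\<dots> \<longleftrightarrow> exp (L ?s) \<le> y / w $ i"
          using True w(2) by (simp add: ln_ge_iff)
        finally show ?thesis using w(2) by (simp add: field_simps)
      next
        case False
        have "w $ i * exp (L ?s) > 0" using w(2) by simp
        then show ?thesis using False nonpos[OF w, of y] \<alpha> by simp
      qed
      then have "{y. \<alpha> \<le> P w y} = {w $ i * exp (L ?s)..}" by auto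
      then show ?thesis by simp
    qed
    show "convex_at (\<lambda>w. Inf {y. \<alpha> \<le> P w y}) u"
      by (rule convex_at_perspective[OF u quant exp_L_deriv exp_L_deriv2[OF t] nn])
  qed
qed

end

section \<open>Disintegration of the bivariate normal law\<close>

lemma measurable_axis_pair:
  "(\<lambda>(a, b). axis i a + axis j b :: real ^ 'n) \<in> borel_measurable borel"
proof -
  have "(\<lambda>(a, b). axis i a + axis j b :: real ^ 'n) = (\<lambda>p. fst p *\<^sub>R axis i 1 + snd p *\<^sub>R axis j 1)"
    by (auto simp: fun_eq_iff vec_eq_iff axis_def)
  also have "\<dots> \<in> borel_measurable borel"
    by (intro borel_measurable_continuous_onI continuous_intros)
  finally show ?thesis .
qed

text \<open>Stated for either enumeration of the two coordinates, since either may play the role of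
  \<open>i\<close>. Boxes pull back to boxes with the same side lengths, and this determines
  Lebesgue measure.\<close>

lemma lborel_pair_vec2:
  fixes i j :: 2
  assumes "i \<noteq> j"
  shows "(lborel :: (real ^ 2) measure) = distr lborel borel (\<lambda>(a, b). axis i a + axis j b)"
proof (rule lborel_eqI)
  let ?f = "\<lambda>(a, b). axis i a + axis j b :: real ^ 2"
  have UNIV: "(UNIV :: 2 set) = {i, j}"
    using assms exhaust_2[of i] exhaust_2[of j] by (auto simp: UNIV_2)
  have Basis: "(Basis :: (real ^ 2) set) = {axis i 1, axis j 1}"
    by (auto simp: Basis_vec_def UNIV)
  have Basis2: "(Basis :: (real \<times> real) set) = {(1, 0), (0, 1)}"
    by (auto simp: Basis_prod_def)
  have ne: "(axis i 1 :: real ^ 2) \<noteq> axis j 1" using assms by (simp add: axis_eq_axis)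
  have [measurable]: "?f \<in> borel_measurable borel"
    by (rule measurable_axis_pair)
  have nth: "axis i a $ i = a" "axis j a $ i = 0" "axis j a $ j = a" "axis i a $ j = 0" for a :: real
    using assms by (auto simp: axis_def)
  fix l u :: "real ^ 2" assume lu: "\<And>b. b \<in> Basis \<Longrightarrow> l \<bullet> b \<le> u \<bullet> b"
  have "?f -` box l u = box (l $ i, l $ j) (u $ i, u $ j)"
    by (auto simp: mem_box Basis Basis2 inner_axis nth)
  then have "emeasure (distr lborel borel ?f) (box l u) = emeasure lborel (box (l $ i, l $ j) (u $ i, u $ j))"
    by (subst emeasure_distr) auto
  also have "\<dots> = (\<Prod>b\<in>Basis. ((u $ i, u $ j) - (l $ i, l $ j)) \<bullet> b)"
    using lu[of "axis i 1"] lu[of "axis j 1"] by (intro emeasure_lborel_box) (auto simp: Basis Basis2 inner_axis)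
  also have "(\<Prod>b\<in>Basis. ((u $ i, u $ j) - (l $ i, l $ j)) \<bullet> b) = (\<Prod>b\<in>Basis. (u - l) \<bullet> b)"
    using ne by (simp add: Basis Basis2 inner_axis)
  finally show "emeasure (distr lborel borel ?f) (box l u) = (\<Prod>b\<in>Basis. (u - l) \<bullet> b)" .
next
  show "sets (distr lborel borel (\<lambda>(a, b). axis i a + axis j b)) = sets (borel :: (real^2) measure)" by simp
qed

text \<open>The shear \<open>b = a + d\<close>, a translation for fixed \<open>a\<close>, followed
  by Fubini: the outer variable becomes the difference of the coordinates.\<close>

lemma nn_integral_vec2:
  fixes i j :: 2 and f :: "real ^ 2 \<Rightarrow> ennreal"
  assumes "i \<noteq> j" and [measurable]: "f \<in> borel_measurable borel"
  shows "(\<integral>\<^sup>+z. f z \<partial>lborel) = (\<integral>\<^sup>+d. (\<integral>\<^sup>+a. f (axis i a + axis j (a + d)) \<partial>lborel) \<partial>lborel)"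
proof -
  let ?f = "\<lambda>(a, b). axis i a + axis j b :: real ^ 2"
  have meas: "?f \<in> borel_measurable borel"
    by (rule measurable_axis_pair)
  have [measurable]: "(\<lambda>x. axis i (g x) + axis j (h x) :: real ^ 2) \<in> borel_measurable N"
    if [measurable]: "g \<in> borel_measurable N" "h \<in> borel_measurable N" for g h :: "'b \<Rightarrow> real" and N :: "'b measure"
    using measurable_compose[OF _ meas, of "\<lambda>x. (g x, h x)" N] by (simp add: borel_prod[symmetric])
  have "(\<integral>\<^sup>+z. f z \<partial>lborel) = (\<integral>\<^sup>+p. f (?f p) \<partial>(lborel :: (real \<times> real) measure))"
    by (subst lborel_pair_vec2[OF assms(1)]) (use meas in \<open>simp add: nn_integral_distr\<close>)
  also have "\<dots> = (\<integral>\<^sup>+a. (\<integral>\<^sup>+b. f (axis i a + axis j b) \<partial>lborel) \<partial>lborel)"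
    unfolding lborel_prod[symmetric] by (subst lborel.nn_integral_fst[symmetric]) (auto simp: split_beta)
  also have "\<dots> = (\<integral>\<^sup>+a. (\<integral>\<^sup>+d. f (axis i a + axis j (a + d)) \<partial>lborel) \<partial>lborel)"
  proof (rule nn_integral_cong)
    fix a
    show "(\<integral>\<^sup>+b. f (axis i a + axis j b) \<partial>lborel) = (\<integral>\<^sup>+d. f (axis i a + axis j (a + d)) \<partial>lborel)"
      using nn_integral_real_affine[of "\<lambda>b. f (axis i a + axis j b)" 1 a] by simp
  qed
  also have "\<dots> = (\<integral>\<^sup>+d. (\<integral>\<^sup>+a. f (axis i a + axis j (a + d)) \<partial>lborel) \<partial>lborel)"
  proof (rule lborel_pair.Fubini')
    show "(\<lambda>(d, a). f (axis i a + axis j (a + d))) \<in> borel_measurable (lborel \<Otimes>\<^sub>M lborel)"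
      unfolding split_beta by measurable
  qed
  finally show ?thesis .
qed

lemma nn_integral_normal_density_atMost:
  assumes "\<sigma> > 0"
  shows "(\<integral>\<^sup>+x. ennreal (normal_density \<mu> \<sigma> x) * indicator {..c} x \<partial>lborel) = ennreal (std_normal_cdf ((c - \<mu>) / \<sigma>))"
proof -
  have "(\<integral>\<^sup>+x. ennreal (normal_density \<mu> \<sigma> x) * indicator {..c} x \<partial>lborel) =
     ennreal \<bar>\<sigma>\<bar> * (\<integral>\<^sup>+x. ennreal (normal_density \<mu> \<sigma> (\<mu> + \<sigma> * x)) * indicator {..c} (\<mu> + \<sigma> * x) \<partial>lborel)"
    using assms by (intro nn_integral_real_affine) auto
  also have "\<dots> = (\<integral>\<^sup>+x. ennreal \<sigma> * (ennreal (normal_density \<mu> \<sigma> (\<mu> + \<sigma> * x)) * indicator {..c} (\<mu> + \<sigma> * x)) \<partial>lborel)"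
    using assms by (subst nn_integral_cmult) auto
  also have "\<dots> = (\<integral>\<^sup>+x. ennreal (std_normal_density x) * indicator {..(c - \<mu>) / \<sigma>} x \<partial>lborel)"
  proof (intro nn_integral_cong)
    fix x
    have "\<sigma> * normal_density \<mu> \<sigma> (\<mu> + \<sigma> * x) = std_normal_density x"
      using assms by (simp add: normal_density_def real_sqrt_mult power_mult_distrib)
    then show "ennreal \<sigma> * (ennreal (normal_density \<mu> \<sigma> (\<mu> + \<sigma> * x)) * indicator {..c} (\<mu> + \<sigma> * x))
      = ennreal (std_normal_density x) * indicator {..(c - \<mu>) / \<sigma>} x"
      using assms by (simp add: mult.assoc[symmetric] ennreal_mult[symmetric] indicator_def field_simps)
  qed
  also have "\<dots> = emeasure std_normal_distribution {..(c - \<mu>) / \<sigma>}"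
    by (simp add: emeasure_density)
  also have "\<dots> = ennreal (std_normal_cdf ((c - \<mu>) / \<sigma>))"
    by (simp add: std_normal_cdf_def cdf_def std_normal.emeasure_eq_measure)
  finally show ?thesis .
qed

text \<open>The adjugate formula, verified by substituting \<open>x = A *v y\<close> instead of
  computing the inverse.\<close>

lemma matrix_inv_quadratic_form2:
  fixes A :: "real ^ 2 ^ 2" and i j :: 2
  assumes "i \<noteq> j" "A $ j $ i = A $ i $ j" "det A \<noteq> 0"
  shows "x \<bullet> (matrix_inv A *v x) =
    (A $ j $ j * (x $ i)\<^sup>2 - 2 * A $ i $ j * (x $ i * x $ j) + A $ i $ i * (x $ j)\<^sup>2) / det A"
proof -
  have sum: "(\<Sum>a\<in>UNIV. f a) = f i + f j" for f :: "2 \<Rightarrow> real"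
    using assms(1) exhaust_2[of i] exhaust_2[of j] by (auto simp: UNIV_2)
  have det: "det A = A $ i $ i * A $ j $ j - A $ i $ j * A $ i $ j"
    using assms(1,2) exhaust_2[of i] exhaust_2[of j] by (auto simp: det_2)
  have "\<exists>B. A ** B = mat 1 \<and> B ** A = mat 1"
    using assms(3) by (simp add: invertible_det_nz[symmetric] invertible_def)
  then have "A ** matrix_inv A = mat 1"
    unfolding matrix_inv_def by (rule someI2_ex) simp
  then have "A *v (matrix_inv A *v x) = x"
    by (simp add: matrix_vector_mul_assoc)
  moreover define y where "y = matrix_inv A *v x"
  ultimately have "A *v y = x" by simp
  then have "(A *v y) $ i = x $ i" "(A *v y) $ j = x $ j" by simp_all
  then have xi: "x $ i = A $ i $ i * y $ i + A $ i $ j * y $ j"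
    and xj: "x $ j = A $ i $ j * y $ i + A $ j $ j * y $ j"
    by (simp_all add: matrix_vector_mult_def sum assms(2))
  have "det A * (x \<bullet> y) = A $ j $ j * (x $ i)\<^sup>2 - 2 * A $ i $ j * (x $ i * x $ j) + A $ i $ i * (x $ j)\<^sup>2"
    unfolding det by (simp add: inner_vec_def sum xi xj power2_eq_square algebra_simps)
  then show ?thesis using assms(3) by (simp add: y_def field_simps)
qed

lemma sym_pos_def_2:
  fixes A :: "real ^ 2 ^ 2" and i j :: 2
  assumes "sym_pos_def A" "i \<noteq> j"
  shows "A $ j $ i = A $ i $ j" "det A > 0" "A $ i $ i - 2 * A $ i $ j + A $ j $ j > 0"
    "det A = A $ i $ i * A $ j $ j - A $ i $ j * A $ i $ j"
proof -
  have sum: "(\<Sum>a\<in>UNIV. f a) = f i + f j" for f :: "2 \<Rightarrow> real"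
    using assms(2) exhaust_2[of i] exhaust_2[of j] by (auto simp: UNIV_2)
  have "transpose A $ i $ j = A $ i $ j" using assms(1) by (simp add: sym_pos_def_def)
  then show sym: "A $ j $ i = A $ i $ j" by (simp add: transpose_def)
  show det: "det A = A $ i $ i * A $ j $ j - A $ i $ j * A $ i $ j"
    using assms(2) sym exhaust_2[of i] exhaust_2[of j] by (auto simp: det_2)
  have form: "p\<^sup>2 * A $ i $ i + 2 * p * q * A $ i $ j + q\<^sup>2 * A $ j $ j > 0" if "p \<noteq> 0 \<or> q \<noteq> 0" for p q
  proof -
    define v :: "real ^ 2" where "v = axis i p + axis j q"
    have v: "v $ i = p" "v $ j = q" using assms(2) by (auto simp: v_def axis_def)
    then have "v \<noteq> 0" using that by auto
    then have "v \<bullet> (A *v v) > 0" using assms(1) by (simp add: sym_pos_def_def)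
    then show ?thesis
      by (simp add: inner_vec_def matrix_vector_mult_def sum v sym power2_eq_square algebra_simps)
  qed
  show "A $ i $ i - 2 * A $ i $ j + A $ j $ j > 0" using form[of 1 "-1"] by simp
  have "A $ i $ i > 0" using form[of 1 0] by simp
  \<comment> \<open>Evaluating the form at \<open>- A $ i $ j\<close>, \<open>A $ i $ i\<close>
    gives exactly this product.\<close>
  moreover have "A $ i $ i * det A > 0"
    using form[of "- A $ i $ j" "A $ i $ i"] \<open>A $ i $ i > 0\<close>
    by (simp add: det power2_eq_square algebra_simps)
  ultimately show "det A > 0" by (simp add: zero_less_mult_iff)
qed

text \<open>Gaussian regression of \<open>Z$i\<close> on \<open>d = Z$j - Z$i\<close>:
  \<open>v\<close> is the variance of \<open>d\<close>, \<open>k\<close> the covariance of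
  \<open>Z$i\<close> and \<open>d\<close> divided by \<open>v\<close>, and \<open>det A / v\<close>
  the residual variance. The proof completes the square in the exponent.\<close>

lemma mvnormal_density_disintegration:
  fixes A :: "real ^ 2 ^ 2" and \<mu> :: "real ^ 2" and i j :: 2
  assumes A: "sym_pos_def A" and ij: "i \<noteq> j"
  defines "v \<equiv> A $ i $ i - 2 * A $ i $ j + A $ j $ j"
  defines "k \<equiv> (A $ i $ j - A $ i $ i) / v"
  shows "mvnormal_density \<mu> A (axis i a + axis j (a + d)) =
    normal_density (\<mu> $ j - \<mu> $ i) (sqrt v) d *
    normal_density (\<mu> $ i - k * (\<mu> $ j - \<mu> $ i) + k * d) (sqrt (det A / v)) a"
proof -
  note sp = sym_pos_def_2[OF A ij, folded v_def]
  define x e where "x = a - \<mu> $ i" and "e = d - (\<mu> $ j - \<mu> $ i)"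
  have comp: "(axis i a + axis j (a + d) - \<mu>) $ i = x" "(axis i a + axis j (a + d) - \<mu>) $ j = x + e"
    using ij by (auto simp: axis_def x_def e_def)
  define q where "q = (axis i a + axis j (a + d) - \<mu>) \<bullet> (matrix_inv A *v (axis i a + axis j (a + d) - \<mu>))"
  have "q = (A $ j $ j * x\<^sup>2 - 2 * A $ i $ j * (x * (x + e)) + A $ i $ i * (x + e)\<^sup>2) / det A"
    unfolding q_def matrix_inv_quadratic_form2[OF ij sp(1) less_imp_neq[OF sp(2), symmetric]] comp ..
  also have "\<dots> = e\<^sup>2 / v + (x - k * e)\<^sup>2 / (det A / v)"
  proof -
    have "v * (A $ j $ j * x\<^sup>2 - 2 * A $ i $ j * (x * (x + e)) + A $ i $ i * (x + e)\<^sup>2)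
      = det A * e\<^sup>2 + (v * x - (A $ i $ j - A $ i $ i) * e)\<^sup>2"
      unfolding sp(4) v_def by (simp add: power2_eq_square algebra_simps)
    moreover have "v * x - (A $ i $ j - A $ i $ i) * e = v * (x - k * e)"
      using sp(3) by (simp add: k_def field_simps)
    ultimately have "v * (A $ j $ j * x\<^sup>2 - 2 * A $ i $ j * (x * (x + e)) + A $ i $ i * (x + e)\<^sup>2)
      = det A * e\<^sup>2 + v\<^sup>2 * (x - k * e)\<^sup>2"
      by (simp add: power_mult_distrib)
    then have "A $ j $ j * x\<^sup>2 - 2 * A $ i $ j * (x * (x + e)) + A $ i $ i * (x + e)\<^sup>2
      = (det A * e\<^sup>2 + v\<^sup>2 * (x - k * e)\<^sup>2) / v"
      using sp(3) by (simp add: eq_divide_eq mult.commute)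
    moreover have "(D * E + v\<^sup>2 * Y) / v / D = E / v + Y / (D / v)" if "D > 0" for D E Y
      using sp(3) that by (simp add: field_simps power2_eq_square)
    ultimately show ?thesis using sp(2) by simp
  qed
  finally have q: "q = e\<^sup>2 / v + (x - k * e)\<^sup>2 / (det A / v)" .
  have "- q / 2 = - e\<^sup>2 / (2 * v) + - (x - k * e)\<^sup>2 / (2 * (det A / v))"
    unfolding q by (simp add: field_simps)
  then have "exp (- q / 2) = exp (- e\<^sup>2 / (2 * v)) * exp (- (x - k * e)\<^sup>2 / (2 * (det A / v)))"
    by (simp only: exp_add)
  moreover have "sqrt ((2 * pi) ^ CARD(2) * det A) = sqrt (2 * pi * v) * sqrt (2 * pi * (det A / v))"
    using sp(3) by (simp add: real_sqrt_mult[symmetric] power2_eq_square)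
  moreover have "(sqrt v)\<^sup>2 = v" "(sqrt (det A / v))\<^sup>2 = det A / v" using sp(2,3) by simp_all
  moreover have "a - (\<mu> $ i - k * (\<mu> $ j - \<mu> $ i) + k * d) = x - k * e"
    by (simp add: x_def e_def algebra_simps)
  ultimately show ?thesis
    unfolding mvnormal_density_def q_def[symmetric] normal_density_def e_def[symmetric] by simp
qed

text \<open>For fixed \<open>d\<close> the event is a half-line in the coordinate \<open>a\<close>,
  so the inner integral is a normal distribution function evaluated at \<open>arg\<close>.\<close>

lemma lognormal_sum_cdf:
  fixes M :: "'a measure" and Z X :: "'a \<Rightarrow> real ^ 2" and i j :: 2
  assumes M: "prob_space M" and A: "sym_pos_def A" and ij: "i \<noteq> j"
    and Z: "distributed M lborel Z (\<lambda>z. ennreal (mvnormal_density \<mu> A z))"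
    and X: "\<And>\<omega> i. \<omega> \<in> space M \<Longrightarrow> X \<omega> $ i = exp (Z \<omega> $ i)"
    and w: "w \<in> quadrant" "w $ i > 0" and y: "y > 0"
  defines "v \<equiv> A $ i $ i - 2 * A $ i $ j + A $ j $ j"
  defines "k \<equiv> (A $ i $ j - A $ i $ i) / v"
  defines "\<delta> \<equiv> \<mu> $ j - \<mu> $ i"
  shows "measure M {\<omega> \<in> space M. w $ i * X \<omega> $ i + w $ j * X \<omega> $ j \<le> y} =
    gauss_mix.F \<delta> (sqrt v) (1 / sqrt (det A / v)) (\<mu> $ i - k * \<delta>) k (ln (y / w $ i)) (w $ j / w $ i)"
proof -
  interpret prob_space M by fact
  note sp = sym_pos_def_2[OF A ij, folded v_def]
  define \<sigma> where "\<sigma> = sqrt (det A / v)"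
  have \<sigma>: "\<sigma> > 0" using sp by (simp add: \<sigma>_def)
  interpret gauss_mix \<delta> "sqrt v" "1 / \<sigma>" "\<mu> $ i - k * \<delta>" k
    using sp \<sigma> by unfold_locales auto
  define B where "B = {z :: real ^ 2. w $ i * exp (z $ i) + w $ j * exp (z $ j) \<le> y}"
  have "closed B" unfolding B_def by (intro closed_Collect_le continuous_intros)
  then have B[measurable]: "B \<in> sets borel" by simp
  have dens[measurable]: "(\<lambda>z. ennreal (mvnormal_density \<mu> A z)) \<in> borel_measurable borel"
    using distributed_borel_measurable[OF Z] by simp
  have wj: "w $ j \<ge> 0" using w exhaust_2[of j] by (auto simp: quadrant_def)
  let ?t = "w $ j / w $ i" and ?l = "ln (y / w $ i)"
  have in_B: "axis i a + axis j (a + d) \<in> B \<longleftrightarrow> a \<le> ?l - ln (1 + ?t * exp d)" for a d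
  proof -
    have pos: "1 + ?t * exp d > 0" using w wj by (simp add: add_pos_nonneg)
    have "axis i a + axis j (a + d) \<in> B \<longleftrightarrow> w $ i * exp a + w $ j * exp (a + d) \<le> y"
      using ij by (auto simp: B_def axis_def)
    also have "w $ i * exp a + w $ j * exp (a + d) = exp a * (1 + ?t * exp d) * w $ i"
      using w by (simp add: algebra_simps exp_add)
    also have "\<dots> \<le> y \<longleftrightarrow> exp a * (1 + ?t * exp d) \<le> y / w $ i"
      using w by (simp only: pos_le_divide_eq)
    also have "\<dots> \<longleftrightarrow> exp a \<le> y / w $ i / (1 + ?t * exp d)"
      by (rule pos_le_divide_eq[OF pos, symmetric])
    also have "\<dots> \<longleftrightarrow> a \<le> ln (y / w $ i / (1 + ?t * exp d))"
      using pos w y by (subst ln_ge_iff) auto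
    also have "ln (y / w $ i / (1 + ?t * exp d)) = ?l - ln (1 + ?t * exp d)"
      using pos w y by (subst ln_div) auto
    finally show ?thesis .
  qed
  have "{\<omega> \<in> space M. w $ i * X \<omega> $ i + w $ j * X \<omega> $ j \<le> y} = Z -` B \<inter> space M"
    using X by (auto simp: B_def)
  then have "emeasure M {\<omega> \<in> space M. w $ i * X \<omega> $ i + w $ j * X \<omega> $ j \<le> y}
     = (\<integral>\<^sup>+z. ennreal (mvnormal_density \<mu> A z) * indicator B z \<partial>lborel)"
    using distributed_emeasure[OF Z, of B] B by simp
  also have "\<dots> = (\<integral>\<^sup>+d. (\<integral>\<^sup>+a. ennreal (mvnormal_density \<mu> A (axis i a + axis j (a + d))) *
      indicator B (axis i a + axis j (a + d)) \<partial>lborel) \<partial>lborel)"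
    by (rule nn_integral_vec2[OF ij]) simp
  also have "\<dots> = (\<integral>\<^sup>+d. ennreal (\<psi> d * std_normal_cdf (arg ?l ?t d)) \<partial>lborel)"
  proof (intro nn_integral_cong)
    fix d
    let ?m = "\<mu> $ i - k * \<delta> + k * d"
    have "(\<integral>\<^sup>+a. ennreal (mvnormal_density \<mu> A (axis i a + axis j (a + d))) * indicator B (axis i a + axis j (a + d)) \<partial>lborel)
      = (\<integral>\<^sup>+a. ennreal (\<psi> d) * (ennreal (normal_density ?m \<sigma> a) * indicator {..?l - ln (1 + ?t * exp d)} a) \<partial>lborel)"
      by (intro nn_integral_cong)
         (simp add: mvnormal_density_disintegration[OF A ij] v_def[symmetric] k_def[symmetric] \<delta>_def[symmetric]
            \<sigma>_def[symmetric] ennreal_mult mult.assoc indicator_def in_B)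
    also have "\<dots> = ennreal (\<psi> d) * ennreal (std_normal_cdf ((?l - ln (1 + ?t * exp d) - ?m) / \<sigma>))"
      by (subst nn_integral_cmult) (simp_all add: nn_integral_normal_density_atMost[OF \<sigma>])
    also have "(?l - ln (1 + ?t * exp d) - ?m) / \<sigma> = arg ?l ?t d"
      by (simp add: arg_def diff_diff_eq)
    finally show "(\<integral>\<^sup>+a. ennreal (mvnormal_density \<mu> A (axis i a + axis j (a + d))) * indicator B (axis i a + axis j (a + d)) \<partial>lborel)
      = ennreal (\<psi> d * std_normal_cdf (arg ?l ?t d))"
      by (simp add: ennreal_mult std_normal_cdf_bounds)
  qed
  also have "\<dots> = ennreal (F ?l ?t)"
    unfolding F_def
    by (intro nn_integral_eq_integral integrable_cdf_arg AE_I2) (simp add: std_normal_cdf_bounds)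
  finally show ?thesis
    unfolding \<sigma>_def[symmetric]
    by (simp add: measure_def F_def integral_nonneg_AE std_normal_cdf_bounds)
qed

theorem theorem3p12:
  fixes M :: "'a measure" and Z X :: "'a \<Rightarrow> real ^ 2"
    and \<mu> :: "real ^ 2" and A :: "real ^ 2 ^ 2"
  assumes "prob_space M"
    and "sym_pos_def A"
    and "distributed M lborel Z (\<lambda>z. ennreal (mvnormal_density \<mu> A z))"
    and "\<And>\<omega> i. \<omega> \<in> space M \<Longrightarrow> X \<omega> $ i = exp (Z \<omega> $ i)"
  shows "\<forall>u :: real ^ 2. u \<noteq> 0 \<and> u $ 1 \<ge> 0 \<and> u $ 2 \<ge> 0 \<longrightarrow>
    (\<exists>\<alpha>\<^sub>0. 0 < \<alpha>\<^sub>0 \<and> \<alpha>\<^sub>0 < 1 \<and>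
      (\<forall>\<alpha>. \<alpha>\<^sub>0 \<le> \<alpha> \<and> \<alpha> < 1 \<longrightarrow>
        convex_at (\<lambda>w. quantile M (\<lambda>\<omega>. w $ 1 * X \<omega> $ 1 + w $ 2 * X \<omega> $ 2) \<alpha>) u))"
proof (intro allI impI)
  fix u :: "real ^ 2" assume u: "u \<noteq> 0 \<and> u $ 1 \<ge> 0 \<and> u $ 2 \<ge> 0"
  define P where "P w y = measure M {\<omega> \<in> space M. w $ 1 * X \<omega> $ 1 + w $ 2 * X \<omega> $ 2 \<le> y}" for w :: "real ^ 2" and y
  have main: "\<exists>\<alpha>\<^sub>0. 0 < \<alpha>\<^sub>0 \<and> \<alpha>\<^sub>0 < 1 \<and> (\<forall>\<alpha>. \<alpha>\<^sub>0 \<le> \<alpha> \<and> \<alpha> < 1 \<longrightarrow> convex_at (\<lambda>w. Inf {y. \<alpha> \<le> P w y}) u)"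
    if ij: "i \<noteq> j" and ui: "u $ i > 0" for i j :: 2
  proof -
    have P: "P w y = measure M {\<omega> \<in> space M. w $ i * X \<omega> $ i + w $ j * X \<omega> $ j \<le> y}" for w y
      using ij exhaust_2[of i] exhaust_2[of j] by (auto simp: P_def add.commute)
    define v where "v = A $ i $ i - 2 * A $ i $ j + A $ j $ j"
    define k where "k = (A $ i $ j - A $ i $ i) / v"
    define \<delta> where "\<delta> = \<mu> $ j - \<mu> $ i"
    note sp = sym_pos_def_2[OF assms(2) ij, folded v_def]
    interpret gauss_mix \<delta> "sqrt v" "1 / sqrt (det A / v)" "\<mu> $ i - k * \<delta>" k
      using sp by unfold_locales auto
    show ?thesis
    proof (rule quantile_convex_at)
      show "P w y = F (ln (y / w $ i)) (w $ j / w $ i)" if "w \<in> quadrant" "w $ i > 0" "y > 0" for w y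
        unfolding P v_def k_def \<delta>_def
        by (rule lognormal_sum_cdf[OF assms(1,2) ij assms(3,4) that])
    next
      fix w :: "real ^ 2" and y :: real assume w: "w \<in> quadrant" "w $ i > 0" and y: "y \<le> 0"
      have "w $ j \<ge> 0" using w exhaust_2[of j] by (auto simp: quadrant_def)
      then have "0 < w $ i * X \<omega> $ i + w $ j * X \<omega> $ j" if "\<omega> \<in> space M" for \<omega>
        using w that by (simp add: assms(4) add_pos_nonneg)
      then have "{\<omega> \<in> space M. w $ i * X \<omega> $ i + w $ j * X \<omega> $ j \<le> y} = {}" using y by force
      then show "P w y = 0" unfolding P by (simp only: measure_empty)
    qed (use u ui in \<open>auto simp: quadrant_def\<close>)
  qed
  \<comment> \<open>A positive coordinate is taken as \<open>i\<close>; a point on an edge then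
    corresponds to weight \<open>t = 0\<close>.\<close>
  have "u $ 1 > 0 \<or> u $ 2 > 0" using u by (auto simp: vec_eq_iff forall_2 less_le)
  then show "\<exists>\<alpha>\<^sub>0. 0 < \<alpha>\<^sub>0 \<and> \<alpha>\<^sub>0 < 1 \<and> (\<forall>\<alpha>. \<alpha>\<^sub>0 \<le> \<alpha> \<and> \<alpha> < 1 \<longrightarrow>
        convex_at (\<lambda>w. quantile M (\<lambda>\<omega>. w $ 1 * X \<omega> $ 1 + w $ 2 * X \<omega> $ 2) \<alpha>) u)"
    unfolding quantile_def P_def[symmetric]
    using main[of 1 2] main[of 2 1] by auto
qed

end
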